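(* Let $G$ be a group and let $1\to R\to Q\xrightarrow{\pi} S\to 1$ and $1\to R'\to Q'\xrightarrow{\pi'} S'\to 1$ be short exact sequences of $G$-groups with the image of $R$ contained in $Z(Q)$ and the image of $R'$ contained in $Z(Q')$. Let $\sigma,\sigma'$ be sections of $\pi,\pi'$ (not necessarily homomorphisms). Let $\zeta:R\to R'$, $\eta:Q\to Q'$, $\theta:S\to S'$ be $G$-equivariant homomorphisms giving a commutative diagram between the two short exact sequences. Consider the induced commutative diagram with exact rows (of pointed sets), where the vertical maps $h_1,\dots,h_5$ are induced by $\theta,\zeta,\eta,\theta,\zeta$ respectively: $$\begin{array}{ccccccccc} S^G &\xrightarrow{\delta}& H^1(G,R)&\xrightarrow{\iota}& H^1(G,Q)&\xrightarrow{\pi_*}& H^1(G,S)&\xrightarrow{\Delta}& H^2(G,R)\\ \downarrow h_1&&\downarrow h_2&&\downarrow h_3&&\downarrow h_4&&\downarrow h_5\\ S'^G &\xrightarrow{\delta'}& H^1(G,R')&\xrightarrow{\iota'}& H^1(G,Q')&\xrightarrow{\pi'_*}& H^1(G,S')&\xrightarrow{\Delta'}& H^2(G,R').\end{array}$$ Then: (i) If $h_2$ and $h_4$ are surjective and $h_5$ is injective, then $h_3$ is surjective. (ii) If $h_2$ and $h_4$ are injective and, for every $\gamma\in Z^1(G,S)$, with $\gamma'=\theta\circ\gamma\in Z^1(G,S')$, the map $S_\gamma^G\to {S'}_{\gamma'}^G$ induced by $\theta$ is surjective, then $h_3$ is injective. (iii) If the hypotheses of (i) and (ii) hold, then $h_3$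 is an isomorphism (of pointed sets).
   Context: A $G$-group is a group $Q$ with a right action $(q,g)\mapsto q^g$ of $G$ by group automorphisms; maps of $G$-groups are $G$-equivariant homomorphisms. Write $q^{-g}=(q^{-1})^g$. $H^0(G,Q)=Q^G=\{q\in Q: q^g=q\ \forall g\in G\}$. $Z^1(G,Q)$ is the set of maps $\gamma:G\to Q$ with $\gamma(gh)=\gamma(g)^h\gamma(h)$; $\gamma\sim\delta$ if there is $q\in Q$ with $\delta(g)=q^{-g}\gamma(g)q$ for all $g$; $H^1(G,Q)=Z^1(G,Q)/\!\sim$, a pointed set with base point the class of the trivial cocycle. For an abelian $G$-group $R$, $Z^2(G,R)$ is the set of maps $\gamma:G\times G\to R$ with $\gamma(gh,k)\gamma(g,h)^k=\gamma(g,hk)\gamma(h,k)$; $\gamma\sim\delta$ if there is a map $\phi:G\to R$ with $\delta(g,h)=\gamma(g,h)\phi(g)^h\phi(h)\phi(gh)^{-1}$; $H^2(G,R)=Z^2(G,R)/\!\sim$, pointed by the class of the trivial cocycle. Maps in the rows: $\iota,\pi_*$ are induced by $R\to Q$ and $Q\to S$; $\delta(s)$ is the class of $g\mapsto \sigma(s)^{-g}\sigma(s)$; $\Delta([\gamma])$ is the class of $(g,h)\mapsto\sigma(\gamma(g))^h\sigma(\gamma(h))\sigma(\gamma(gh))^{-1}$ (elements of $R$ identified with their images in $Q$); similarly for the second row with $\sigma'$. The vertical maps on cohomology are composition of cocycles with $\zeta$, $\eta$ or $\theta$. Twisting: for $\gamma\in Z^1(G,S)$, $S_\gamma$ is the group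 $S$ with the new $G$-action $s*g=\gamma(g)^{-1}s^g\gamma(g)$; $S_\gamma^G$ is its group of $G$-fixed points; similarly for $S'_{\gamma'}$. *)

theory Defs
  imports "HOL-Algebra.Coset"
begin

section \<open>Groups with a right action of a group by automorphisms\<close>

record ('a, 'g) ggrp = "'a monoid" +
  gact :: "'a \<Rightarrow> 'g \<Rightarrow> 'a"  (infixl \<open>\<triangleleft>\<index>\<close> 75)

locale g_group = G: group G + Q: group Q
  for G :: "('g, 'x) monoid_scheme" and Q :: "('q, 'g, 'y) ggrp_scheme" +
  assumes act_auto: "g \<in> carrier G \<Longrightarrow> (\<lambda>q. q \<triangleleft>\<^bsub>Q\<^esub> g) \<in> iso Q Q"
    and act_one: "q \<in> carrier Q \<Longrightarrow> q \<triangleleft>\<^bsub>Q\<^esub> \<one>\<^bsub>G\<^esub> = q"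
    and act_mult: "\<lbrakk>q \<in> carrier Q; g \<in> carrier G; h \<in> carrier G\<rbrakk>
      \<Longrightarrow> q \<triangleleft>\<^bsub>Q\<^esub> (g \<otimes>\<^bsub>G\<^esub> h) = q \<triangleleft>\<^bsub>Q\<^esub> g \<triangleleft>\<^bsub>Q\<^esub> h"

definition g_hom ::
  "('g, 'x) monoid_scheme \<Rightarrow> ('q, 'g, 'y) ggrp_scheme \<Rightarrow> ('s, 'g, 'z) ggrp_scheme \<Rightarrow> ('q \<Rightarrow> 's) set"
  where "g_hom G Q S =
    {f \<in> hom Q S. \<forall>q\<in>carrier Q. \<forall>g\<in>carrier G. f (q \<triangleleft>\<^bsub>Q\<^esub> g) = f q \<triangleleft>\<^bsub>S\<^esub> g}"

definition center :: "('a, 'b) monoid_scheme \<Rightarrow> 'a set"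
  where "center Q = {z \<in> carrier Q. \<forall>q\<in>carrier Q. z \<otimes>\<^bsub>Q\<^esub> q = q \<otimes>\<^bsub>Q\<^esub> z}"

text \<open>
  The library notion in \<open>HOL-Algebra.Exact_Sequence\<close> requires all groups to have the same element
  type and carries no action.
\<close>

definition g_short_exact ::
  "('g, 'x) monoid_scheme \<Rightarrow> ('r, 'g, 'u) ggrp_scheme \<Rightarrow> ('q, 'g, 'v) ggrp_scheme
    \<Rightarrow> ('s, 'g, 'w) ggrp_scheme \<Rightarrow> ('r \<Rightarrow> 'q) \<Rightarrow> ('q \<Rightarrow> 's) \<Rightarrow> bool"
  where "g_short_exact G R Q S \<iota> \<pi> \<longleftrightarrow>
    g_group G R \<and> g_group G Q \<and> g_group G S \<and> \<iota> \<in> g_hom G R Q \<and> \<pi> \<in> g_hom G Q S \<and>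
    inj_on \<iota> (carrier R) \<and> \<iota> ` carrier R = kernel Q S \<pi> \<and> \<pi> ` carrier Q = carrier S"

definition set_section ::
  "('q, 'v) monoid_scheme \<Rightarrow> ('s, 'w) monoid_scheme \<Rightarrow> ('q \<Rightarrow> 's) \<Rightarrow> ('s \<Rightarrow> 'q) \<Rightarrow> bool"
  where "set_section Q S \<pi> \<sigma> \<longleftrightarrow>
    \<sigma> \<in> carrier S \<rightarrow> carrier Q \<and> (\<forall>s\<in>carrier S. \<pi> (\<sigma> s) = s)"


section \<open>Cohomology\<close>

text \<open>
  Cocycles are extensional functions, so that they are determined by their values on
  \<^term>\<open>carrier G\<close>.
\<close>

definition H0 :: "('g, 'x) monoid_scheme \<Rightarrow> ('q, 'g, 'y) ggrp_scheme \<Rightarrow> 'q set"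
  where "H0 G Q = {q \<in> carrier Q. \<forall>g\<in>carrier G. q \<triangleleft>\<^bsub>Q\<^esub> g = q}"

definition Z1 :: "('g, 'x) monoid_scheme \<Rightarrow> ('q, 'g, 'y) ggrp_scheme \<Rightarrow> ('g \<Rightarrow> 'q) set"
  where "Z1 G Q = {\<gamma> \<in> carrier G \<rightarrow>\<^sub>E carrier Q.
    \<forall>g\<in>carrier G. \<forall>h\<in>carrier G. \<gamma> (g \<otimes>\<^bsub>G\<^esub> h) = \<gamma> g \<triangleleft>\<^bsub>Q\<^esub> h \<otimes>\<^bsub>Q\<^esub> \<gamma> h}"

definition H1_rel ::
  "('g, 'x) monoid_scheme \<Rightarrow> ('q, 'g, 'y) ggrp_scheme \<Rightarrow> (('g \<Rightarrow> 'q) \<times> ('g \<Rightarrow> 'q)) set"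
  where "H1_rel G Q = {(\<gamma>, \<delta>). \<gamma> \<in> Z1 G Q \<and> \<delta> \<in> Z1 G Q \<and>
    (\<exists>q\<in>carrier Q. \<forall>g\<in>carrier G. \<delta> g = (inv\<^bsub>Q\<^esub> q) \<triangleleft>\<^bsub>Q\<^esub> g \<otimes>\<^bsub>Q\<^esub> \<gamma> g \<otimes>\<^bsub>Q\<^esub> q)}"

definition H1 :: "('g, 'x) monoid_scheme \<Rightarrow> ('q, 'g, 'y) ggrp_scheme \<Rightarrow> ('g \<Rightarrow> 'q) set set"
  where "H1 G Q = Z1 G Q // H1_rel G Q"

definition H1_class ::
  "('g, 'x) monoid_scheme \<Rightarrow> ('q, 'g, 'y) ggrp_scheme \<Rightarrow> ('g \<Rightarrow> 'q) \<Rightarrow> ('g \<Rightarrow> 'q) set"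
  where "H1_class G Q \<gamma> = H1_rel G Q `` {\<gamma>}"

definition H1_base :: "('g, 'x) monoid_scheme \<Rightarrow> ('q, 'g, 'y) ggrp_scheme \<Rightarrow> ('g \<Rightarrow> 'q) set"
  where "H1_base G Q = H1_class G Q (\<lambda>g\<in>carrier G. \<one>\<^bsub>Q\<^esub>)"

text \<open>The coefficient group is meant to be abelian in degree 2.\<close>

definition Z2 :: "('g, 'x) monoid_scheme \<Rightarrow> ('r, 'g, 'y) ggrp_scheme \<Rightarrow> ('g \<times> 'g \<Rightarrow> 'r) set"
  where "Z2 G R = {\<gamma> \<in> carrier G \<times> carrier G \<rightarrow>\<^sub>E carrier R.
    \<forall>g\<in>carrier G. \<forall>h\<in>carrier G. \<forall>k\<in>carrier G.
      \<gamma> (g \<otimes>\<^bsub>G\<^esub> h, k) \<otimes>\<^bsub>R\<^esub> \<gamma> (g, h) \<triangleleft>\<^bsub>R\<^esub> k = \<gamma> (g, h \<otimes>\<^bsub>G\<^esub> k) \<otimes>\<^bsub>R\<^esub> \<gamma> (h, k)}"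

definition H2_rel ::
  "('g, 'x) monoid_scheme \<Rightarrow> ('r, 'g, 'y) ggrp_scheme \<Rightarrow> (('g \<times> 'g \<Rightarrow> 'r) \<times> ('g \<times> 'g \<Rightarrow> 'r)) set"
  where "H2_rel G R = {(\<gamma>, \<delta>). \<gamma> \<in> Z2 G R \<and> \<delta> \<in> Z2 G R \<and>
    (\<exists>\<phi>\<in>carrier G \<rightarrow> carrier R. \<forall>g\<in>carrier G. \<forall>h\<in>carrier G.
      \<delta> (g, h) = \<gamma> (g, h) \<otimes>\<^bsub>R\<^esub> \<phi> g \<triangleleft>\<^bsub>R\<^esub> h \<otimes>\<^bsub>R\<^esub> \<phi> h \<otimes>\<^bsub>R\<^esub> inv\<^bsub>R\<^esub> (\<phi> (g \<otimes>\<^bsub>G\<^esub> h)))}"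

definition H2 :: "('g, 'x) monoid_scheme \<Rightarrow> ('r, 'g, 'y) ggrp_scheme \<Rightarrow> ('g \<times> 'g \<Rightarrow> 'r) set set"
  where "H2 G R = Z2 G R // H2_rel G R"

definition H2_class ::
  "('g, 'x) monoid_scheme \<Rightarrow> ('r, 'g, 'y) ggrp_scheme \<Rightarrow> ('g \<times> 'g \<Rightarrow> 'r) \<Rightarrow> ('g \<times> 'g \<Rightarrow> 'r) set"
  where "H2_class G R \<gamma> = H2_rel G R `` {\<gamma>}"

definition H2_base :: "('g, 'x) monoid_scheme \<Rightarrow> ('r, 'g, 'y) ggrp_scheme \<Rightarrow> ('g \<times> 'g \<Rightarrow> 'r) set"
  where "H2_base G R = H2_class G R (\<lambda>p\<in>carrier G \<times> carrier G. \<one>\<^bsub>R\<^esub>)"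


section \<open>Maps on cohomology\<close>

text \<open>
  A map out of a set of classes is the union over the representatives of the classes of their
  images; these classes coincide when the map is well-defined.
\<close>

definition H1_map ::
  "('g, 'x) monoid_scheme \<Rightarrow> ('s, 'g, 'y) ggrp_scheme \<Rightarrow> ('q \<Rightarrow> 's)
    \<Rightarrow> ('g \<Rightarrow> 'q) set \<Rightarrow> ('g \<Rightarrow> 's) set"
  where "H1_map G S f X = (\<Union>\<gamma>\<in>X. H1_class G S (compose (carrier G) f \<gamma>))"

definition H2_map ::
  "('g, 'x) monoid_scheme \<Rightarrow> ('s, 'g, 'y) ggrp_scheme \<Rightarrow> ('q \<Rightarrow> 's)
    \<Rightarrow> ('g \<times> 'g \<Rightarrow> 'q) set \<Rightarrow> ('g \<times> 'g \<Rightarrow> 's) set"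
  where "H2_map G S f X = (\<Union>\<gamma>\<in>X. H2_class G S (compose (carrier G \<times> carrier G) f \<gamma>))"

text \<open>
  The connecting maps. The inverse of \<open>\<iota>\<close> expresses the identification of \<open>R\<close> with its image
  in \<open>Q\<close>.
\<close>

definition conn0 ::
  "('g, 'x) monoid_scheme \<Rightarrow> ('r, 'g, 'u) ggrp_scheme \<Rightarrow> ('q, 'g, 'v) ggrp_scheme
    \<Rightarrow> ('r \<Rightarrow> 'q) \<Rightarrow> ('s \<Rightarrow> 'q) \<Rightarrow> 's \<Rightarrow> ('g \<Rightarrow> 'r) set"
  where "conn0 G R Q \<iota> \<sigma> s = H1_class G R (\<lambda>g\<in>carrier G.
    inv_into (carrier R) \<iota> ((inv\<^bsub>Q\<^esub> (\<sigma> s)) \<triangleleft>\<^bsub>Q\<^esub> g \<otimes>\<^bsub>Q\<^esub> \<sigma> s))"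

definition conn1 ::
  "('g, 'x) monoid_scheme \<Rightarrow> ('r, 'g, 'u) ggrp_scheme \<Rightarrow> ('q, 'g, 'v) ggrp_scheme
    \<Rightarrow> ('r \<Rightarrow> 'q) \<Rightarrow> ('s \<Rightarrow> 'q) \<Rightarrow> ('g \<Rightarrow> 's) set \<Rightarrow> ('g \<times> 'g \<Rightarrow> 'r) set"
  where "conn1 G R Q \<iota> \<sigma> X = (\<Union>\<gamma>\<in>X. H2_class G R (\<lambda>(g, h)\<in>carrier G \<times> carrier G.
    inv_into (carrier R) \<iota>
      (\<sigma> (\<gamma> g) \<triangleleft>\<^bsub>Q\<^esub> h \<otimes>\<^bsub>Q\<^esub> \<sigma> (\<gamma> h) \<otimes>\<^bsub>Q\<^esub> inv\<^bsub>Q\<^esub> (\<sigma> (\<gamma> (g \<otimes>\<^bsub>G\<^esub> h))))))"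


section \<open>Pointed sets\<close>

definition pointed_map :: "'a set \<Rightarrow> 'a \<Rightarrow> 'b set \<Rightarrow> 'b \<Rightarrow> ('a \<Rightarrow> 'b) \<Rightarrow> bool"
  where "pointed_map A a B b f \<longleftrightarrow> f \<in> A \<rightarrow> B \<and> f a = b"

definition pointed_iso :: "'a set \<Rightarrow> 'a \<Rightarrow> 'b set \<Rightarrow> 'b \<Rightarrow> ('a \<Rightarrow> 'b) \<Rightarrow> bool"
  where "pointed_iso A a B b f \<longleftrightarrow> pointed_map A a B b f \<and> bij_betw f A B"

definition exact_at :: "'a set \<Rightarrow> ('a \<Rightarrow> 'b) \<Rightarrow> 'b set \<Rightarrow> ('b \<Rightarrow> 'c) \<Rightarrow> 'c \<Rightarrow> bool"
  where "exact_at A f B g c \<longleftrightarrow> f ` A = {b \<in> B. g b = c}"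

definition exact_row ::
  "('g, 'x) monoid_scheme \<Rightarrow> ('r, 'g, 'u) ggrp_scheme \<Rightarrow> ('q, 'g, 'v) ggrp_scheme
    \<Rightarrow> ('s, 'g, 'w) ggrp_scheme \<Rightarrow> ('r \<Rightarrow> 'q) \<Rightarrow> ('q \<Rightarrow> 's) \<Rightarrow> ('s \<Rightarrow> 'q) \<Rightarrow> bool"
  where "exact_row G R Q S \<iota> \<pi> \<sigma> \<longleftrightarrow>
    pointed_map (H0 G S) \<one>\<^bsub>S\<^esub> (H1 G R) (H1_base G R) (conn0 G R Q \<iota> \<sigma>) \<and>
    pointed_map (H1 G R) (H1_base G R) (H1 G Q) (H1_base G Q) (H1_map G Q \<iota>) \<and>
    pointed_map (H1 G Q) (H1_base G Q) (H1 G S) (H1_base G S) (H1_map G S \<pi>) \<and>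
    pointed_map (H1 G S) (H1_base G S) (H2 G R) (H2_base G R) (conn1 G R Q \<iota> \<sigma>) \<and>
    exact_at (H0 G S) (conn0 G R Q \<iota> \<sigma>) (H1 G R) (H1_map G Q \<iota>) (H1_base G Q) \<and>
    exact_at (H1 G R) (H1_map G Q \<iota>) (H1 G Q) (H1_map G S \<pi>) (H1_base G S) \<and>
    exact_at (H1 G Q) (H1_map G S \<pi>) (H1 G S) (conn1 G R Q \<iota> \<sigma>) (H2_base G R)"


section \<open>Twisting\<close>

definition twist :: "('s, 'g, 'y) ggrp_scheme \<Rightarrow> ('g \<Rightarrow> 's) \<Rightarrow> ('s, 'g, 'y) ggrp_scheme"
  where "twist S \<gamma> = S\<lparr>gact := \<lambda>s g. inv\<^bsub>S\<^esub> (\<gamma> g) \<otimes>\<^bsub>S\<^esub> s \<triangleleft>\<^bsub>S\<^esub> g \<otimes>\<^bsub>S\<^esub> \<gamma> g\<rparr>"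

end

theory Submission
  imports Defs
begin

text \<open>
  For central extensions the usual diagram chases work on cochains. Any two cocycles in \<open>Q\<close> with
  cohomologous images in \<open>S\<close> differ, up to a coboundary move \<open>cob\<close>, by a cocycle in \<open>R\<close> (the
  operation \<open>tw\<close>), and the obstruction \<open>obs a\<close> to a lift \<open>a\<close> of an \<open>S\<close>-cocycle being a
  \<open>Q\<close>-cocycle is a 2-cocycle whose class does not depend on the lift. Since these sets are only
  pointed, the kernel of \<open>h\<^sub>3\<close> does not control its fibres; the fixed points of the twisted groups
  \<open>S\<^sub>\<gamma>\<close> replace the map \<open>h\<^sub>1\<close> there.
\<close>

section \<open>Groups with operators\<close>

text \<open>Centrality of R turns pointwise multiplication by R-cocycles into an action on the
  Q-cocycles. Its orbits are exactly the fibres over the S-cocycles, and it commutes with coboundary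
  moves by elements of Q. Exactness at a base point says nothing about the other fibres, so both
  chases run through this action and not through the exact rows alone. Injectivity of h3 hinges on
  when \<open>tw \<rho> \<gamma>\<close> is cohomologous to \<open>\<gamma>\<close>. An element of Q
  that moves one to the other has an image in S that stabilises the image of
  \<open>\<gamma>\<close>, and this stabiliser is the fixed-point group of a twist of S. For the
  trivial cocycle it is S^G, so the hypothesis there is surjectivity of h1; the other fibres need
  the other twists. A section is an arbitrary map, compatible neither with products nor with the
  action. Hence the connecting cocycles are built from an arbitrary lift, and
  \<open>\<sigma>\<close> is only one choice of it.\<close>

context g_group
begin

lemma act_closed [simp, intro]:
  "\<lbrakk>q \<in> carrier Q; g \<in> carrier G\<rbrakk> \<Longrightarrow> q \<triangleleft>\<^bsub>Q\<^esub> g \<in> carrier Q"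
  using act_auto[of g] by (auto simp: iso_def hom_def)

lemma act_hom: "g \<in> carrier G \<Longrightarrow> (\<lambda>q. q \<triangleleft>\<^bsub>Q\<^esub> g) \<in> hom Q Q"
  using act_auto[of g] by (auto simp: iso_def)

lemma act_group_hom: "g \<in> carrier G \<Longrightarrow> group_hom Q Q (\<lambda>q. q \<triangleleft>\<^bsub>Q\<^esub> g)"
  by (simp add: group_hom_def group_hom_axioms_def act_hom)

lemma act_distrib:
  "\<lbrakk>p \<in> carrier Q; q \<in> carrier Q; g \<in> carrier G\<rbrakk>
    \<Longrightarrow> (p \<otimes>\<^bsub>Q\<^esub> q) \<triangleleft>\<^bsub>Q\<^esub> g = p \<triangleleft>\<^bsub>Q\<^esub> g \<otimes>\<^bsub>Q\<^esub> q \<triangleleft>\<^bsub>Q\<^esub> g"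
  using act_hom[of g] by (auto simp: hom_def)

lemma one_act [simp]: "g \<in> carrier G \<Longrightarrow> \<one>\<^bsub>Q\<^esub> \<triangleleft>\<^bsub>Q\<^esub> g = \<one>\<^bsub>Q\<^esub>"
  using group_hom.hom_one[OF act_group_hom] .

lemma inv_act:
  "\<lbrakk>q \<in> carrier Q; g \<in> carrier G\<rbrakk> \<Longrightarrow> (inv\<^bsub>Q\<^esub> q) \<triangleleft>\<^bsub>Q\<^esub> g = inv\<^bsub>Q\<^esub> (q \<triangleleft>\<^bsub>Q\<^esub> g)"
  using group_hom.hom_inv[OF act_group_hom] .

lemma inv_mult_cancel:
  "\<lbrakk>p \<in> carrier Q; q \<in> carrier Q\<rbrakk> \<Longrightarrow> inv\<^bsub>Q\<^esub> p \<otimes>\<^bsub>Q\<^esub> (p \<otimes>\<^bsub>Q\<^esub> q) = q"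
  by (simp add: Q.m_assoc[symmetric])

lemma mult_inv_cancel:
  "\<lbrakk>p \<in> carrier Q; q \<in> carrier Q\<rbrakk> \<Longrightarrow> p \<otimes>\<^bsub>Q\<^esub> (inv\<^bsub>Q\<^esub> p \<otimes>\<^bsub>Q\<^esub> q) = q"
  by (simp add: Q.m_assoc[symmetric])

text \<open>Rewrites to a right-associated word whose letters are acted-on elements or their
  inverses, with adjacent inverse pairs cancelled. Identities in the noncommutative group then
  become syntactic.\<close>

lemmas word_simps =
  Q.m_assoc Q.inv_mult_group inv_mult_cancel mult_inv_cancel act_distrib inv_act act_mult

end

section \<open>Coboundary moves as a group action, and first cohomology classes\<close>

definition cob ::
  "('g, 'x) monoid_scheme \<Rightarrow> ('q, 'g, 'y) ggrp_scheme \<Rightarrow> 'q \<Rightarrow> ('g \<Rightarrow> 'q) \<Rightarrow> 'g \<Rightarrow> 'q"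
  where "cob G Q q \<gamma> = (\<lambda>g\<in>carrier G. (inv\<^bsub>Q\<^esub> q) \<triangleleft>\<^bsub>Q\<^esub> g \<otimes>\<^bsub>Q\<^esub> \<gamma> g \<otimes>\<^bsub>Q\<^esub> q)"

lemma Z1_closed: "\<lbrakk>\<gamma> \<in> Z1 G Q; g \<in> carrier G\<rbrakk> \<Longrightarrow> \<gamma> g \<in> carrier Q"
  by (auto simp: Z1_def)

lemma Z1_mult:
  "\<lbrakk>\<gamma> \<in> Z1 G Q; g \<in> carrier G; h \<in> carrier G\<rbrakk>
    \<Longrightarrow> \<gamma> (g \<otimes>\<^bsub>G\<^esub> h) = \<gamma> g \<triangleleft>\<^bsub>Q\<^esub> h \<otimes>\<^bsub>Q\<^esub> \<gamma> h"
  by (auto simp: Z1_def)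

lemma Z1_extensional: "\<gamma> \<in> Z1 G Q \<Longrightarrow> \<gamma> \<in> extensional (carrier G)"
  by (auto simp: Z1_def PiE_def)

lemma Z1I:
  "\<lbrakk>\<gamma> \<in> extensional (carrier G); \<And>g. g \<in> carrier G \<Longrightarrow> \<gamma> g \<in> carrier Q;
    \<And>g h. \<lbrakk>g \<in> carrier G; h \<in> carrier G\<rbrakk> \<Longrightarrow> \<gamma> (g \<otimes>\<^bsub>G\<^esub> h) = \<gamma> g \<triangleleft>\<^bsub>Q\<^esub> h \<otimes>\<^bsub>Q\<^esub> \<gamma> h\<rbrakk>
    \<Longrightarrow> \<gamma> \<in> Z1 G Q"
  by (auto simp: Z1_def PiE_def)

lemma Z1_eqI:
  "\<lbrakk>\<gamma> \<in> Z1 G Q; \<delta> \<in> Z1 G Q; \<And>g. g \<in> carrier G \<Longrightarrow> \<gamma> g = \<delta> g\<rbrakk> \<Longrightarrow> \<gamma> = \<delta>"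
  by (metis Z1_extensional extensionalityI)

lemma cob_in_extensional [simp]: "cob G Q q \<gamma> \<in> extensional (carrier G)"
  by (simp add: cob_def)

context g_group
begin

lemma cob_Z1: "\<lbrakk>q \<in> carrier Q; \<gamma> \<in> Z1 G Q\<rbrakk> \<Longrightarrow> cob G Q q \<gamma> \<in> Z1 G Q"
  by (rule Z1I) (simp_all add: cob_def Z1_closed Z1_mult word_simps)

lemma cob_one: "\<gamma> \<in> Z1 G Q \<Longrightarrow> cob G Q \<one>\<^bsub>Q\<^esub> \<gamma> = \<gamma>"
  by (rule extensionalityI[of _ "carrier G"])
    (auto simp: cob_def Z1_closed Z1_extensional)

text \<open>Together with \<open>cob_one\<close> this is a right action of Q on
  \<open>Z1 G Q\<close>; the classes in H^1 are its orbits. Symmetry and transitivity of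
  \<open>H1_rel\<close> reduce to the laws of an action.\<close>

lemma cob_cob:
  "\<lbrakk>p \<in> carrier Q; q \<in> carrier Q; \<gamma> \<in> Z1 G Q\<rbrakk>
    \<Longrightarrow> cob G Q q (cob G Q p \<gamma>) = cob G Q (p \<otimes>\<^bsub>Q\<^esub> q) \<gamma>"
  by (rule extensionalityI[of _ "carrier G"])
    (auto simp: cob_def Z1_closed word_simps)

lemma H1_rel_iff: "(\<gamma>, \<delta>) \<in> H1_rel G Q \<longleftrightarrow> \<gamma> \<in> Z1 G Q \<and> (\<exists>q\<in>carrier Q. \<delta> = cob G Q q \<gamma>)"
proof
  assume "(\<gamma>, \<delta>) \<in> H1_rel G Q"
  then obtain q where "\<gamma> \<in> Z1 G Q" "\<delta> \<in> Z1 G Q" "q \<in> carrier Q"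
    "\<forall>g\<in>carrier G. \<delta> g = (inv\<^bsub>Q\<^esub> q) \<triangleleft>\<^bsub>Q\<^esub> g \<otimes>\<^bsub>Q\<^esub> \<gamma> g \<otimes>\<^bsub>Q\<^esub> q"
    by (auto simp: H1_rel_def)
  then show "\<gamma> \<in> Z1 G Q \<and> (\<exists>q\<in>carrier Q. \<delta> = cob G Q q \<gamma>)"
    by (auto intro!: bexI[of _ q] extensionalityI[of _ "carrier G"] simp: Z1_extensional cob_def)
next
  assume "\<gamma> \<in> Z1 G Q \<and> (\<exists>q\<in>carrier Q. \<delta> = cob G Q q \<gamma>)"
  then obtain q where "\<gamma> \<in> Z1 G Q" "q \<in> carrier Q" "\<delta> = cob G Q q \<gamma>"
    by auto
  then show "(\<gamma>, \<delta>) \<in> H1_rel G Q"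
    using cob_Z1[of q \<gamma>] by (auto simp: H1_rel_def cob_def)
qed

lemma equiv_H1_rel: "equiv (Z1 G Q) (H1_rel G Q)"
proof (rule equivI)
  show "H1_rel G Q \<subseteq> Z1 G Q \<times> Z1 G Q"
    by (auto simp: H1_rel_def)
  show "refl_on (Z1 G Q) (H1_rel G Q)"
    by (auto simp: refl_on_def H1_rel_iff intro!: bexI[of _ "\<one>\<^bsub>Q\<^esub>"] cob_one[symmetric])
  show "sym (H1_rel G Q)"
  proof (rule symI)
    fix \<gamma> \<delta> assume "(\<gamma>, \<delta>) \<in> H1_rel G Q"
    then obtain q where q: "\<gamma> \<in> Z1 G Q" "q \<in> carrier Q" "\<delta> = cob G Q q \<gamma>"
      by (auto simp: H1_rel_iff)
    then have "\<gamma> = cob G Q (inv\<^bsub>Q\<^esub> q) \<delta>"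
      by (simp add: cob_cob cob_one)
    with q show "(\<delta>, \<gamma>) \<in> H1_rel G Q"
      by (metis H1_rel_iff Q.inv_closed cob_Z1)
  qed
  show "trans (H1_rel G Q)"
    by (rule transI) (metis H1_rel_iff Q.m_closed cob_cob)
qed

lemma H1_class_eq_iff:
  "\<lbrakk>\<gamma> \<in> Z1 G Q; \<delta> \<in> Z1 G Q\<rbrakk>
    \<Longrightarrow> H1_class G Q \<gamma> = H1_class G Q \<delta> \<longleftrightarrow> (\<exists>q\<in>carrier Q. \<delta> = cob G Q q \<gamma>)"
  unfolding H1_class_def
  by (metis H1_rel_iff equiv_H1_rel eq_equiv_class_iff)

lemma H1_class_cob:
  "\<lbrakk>\<gamma> \<in> Z1 G Q; q \<in> carrier Q\<rbrakk> \<Longrightarrow> H1_class G Q (cob G Q q \<gamma>) = H1_class G Q \<gamma>"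
  by (metis H1_class_eq_iff cob_Z1)

lemma mem_H1_class_iff:
  "\<gamma> \<in> Z1 G Q \<Longrightarrow> \<delta> \<in> H1_class G Q \<gamma> \<longleftrightarrow> (\<exists>q\<in>carrier Q. \<delta> = cob G Q q \<gamma>)"
  by (simp add: H1_class_def H1_rel_iff)

lemma H1_class_in_H1: "\<gamma> \<in> Z1 G Q \<Longrightarrow> H1_class G Q \<gamma> \<in> H1 G Q"
  by (auto simp: H1_class_def H1_def quotientI)

lemma trivial_Z1: "(\<lambda>g\<in>carrier G. \<one>\<^bsub>Q\<^esub>) \<in> Z1 G Q"
  by (rule Z1I) auto

text \<open>\<open>H1_map\<close> takes a union over all representatives. Once the class of the
  image is constant along the orbit, the union of this nonempty constant family is its common
  value.\<close>

lemma H1_map_on_class: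
  assumes \<gamma>: "\<gamma> \<in> Z1 G Q"
    and const: "\<And>q. q \<in> carrier Q \<Longrightarrow>
      H1_class G S (compose (carrier G) f (cob G Q q \<gamma>)) = H1_class G S (compose (carrier G) f \<gamma>)"
  shows "H1_map G S f (H1_class G Q \<gamma>) = H1_class G S (compose (carrier G) f \<gamma>)"
proof -
  have "\<gamma> \<in> H1_class G Q \<gamma>"
    using \<gamma> by (metis Q.one_closed cob_one mem_H1_class_iff)
  moreover have "H1_class G S (compose (carrier G) f \<delta>) = H1_class G S (compose (carrier G) f \<gamma>)"
    if "\<delta> \<in> H1_class G Q \<gamma>" for \<delta>
    using that const \<gamma> by (auto simp: mem_H1_class_iff)
  ultimately show ?thesis
    unfolding H1_map_def by (metis (no_types, lifting) SUP_eq_const equals0D)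
qed

end

lemma H1E:
  assumes "x \<in> H1 G Q" obtains \<gamma> where "\<gamma> \<in> Z1 G Q" "x = H1_class G Q \<gamma>"
  using assms by (auto simp: H1_def H1_class_def quotient_def)

section \<open>Equivariant homomorphisms and the maps they induce in degrees zero and one\<close>

locale g_group_hom = Q: g_group G Q + S: g_group G S
  for G :: "('g, 'x) monoid_scheme" and Q :: "('q, 'g, 'y) ggrp_scheme"
    and S :: "('s, 'g, 'z) ggrp_scheme" +
  fixes f :: "'q \<Rightarrow> 's"
  assumes g_hom: "f \<in> g_hom G Q S"
begin

sublocale group_hom Q S f
  using g_hom by unfold_locales (simp add: g_hom_def)

lemma hom_act: "\<lbrakk>q \<in> carrier Q; g \<in> carrier G\<rbrakk> \<Longrightarrow> f (q \<triangleleft>\<^bsub>Q\<^esub> g) = f q \<triangleleft>\<^bsub>S\<^esub> g"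
  using g_hom by (simp add: g_hom_def)

lemma compose_Z1: "\<gamma> \<in> Z1 G Q \<Longrightarrow> compose (carrier G) f \<gamma> \<in> Z1 G S"
  by (rule Z1I) (simp_all add: compose_def Z1_closed Z1_mult hom_act)

lemma compose_cob:
  "\<lbrakk>q \<in> carrier Q; \<gamma> \<in> carrier G \<rightarrow> carrier Q\<rbrakk>
    \<Longrightarrow> compose (carrier G) f (cob G Q q \<gamma>) = cob G S (f q) (compose (carrier G) f \<gamma>)"
  by (rule extensionalityI[of _ "carrier G"]) (auto simp: compose_def cob_def hom_act Pi_iff)

lemma compose_trivial:
  "compose (carrier G) f (\<lambda>g\<in>carrier G. \<one>\<^bsub>Q\<^esub>) = (\<lambda>g\<in>carrier G. \<one>\<^bsub>S\<^esub>)"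
  by (auto simp: compose_def fun_eq_iff)

lemma H1_map_class:
  assumes "\<gamma> \<in> Z1 G Q"
  shows "H1_map G S f (H1_class G Q \<gamma>) = H1_class G S (compose (carrier G) f \<gamma>)"
proof (rule Q.H1_map_on_class[OF assms])
  fix q assume "q \<in> carrier Q"
  moreover have "\<gamma> \<in> carrier G \<rightarrow> carrier Q"
    using assms by (auto simp: Z1_closed)
  ultimately show "H1_class G S (compose (carrier G) f (cob G Q q \<gamma>))
      = H1_class G S (compose (carrier G) f \<gamma>)"
    by (simp add: compose_cob S.H1_class_cob compose_Z1 assms)
qed

lemma pointed_map_H0: "pointed_map (H0 G Q) \<one>\<^bsub>Q\<^esub> (H0 G S) \<one>\<^bsub>S\<^esub> f"
  by (auto simp: pointed_map_def H0_def hom_act[symmetric])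

lemma pointed_map_H1: "pointed_map (H1 G Q) (H1_base G Q) (H1 G S) (H1_base G S) (H1_map G S f)"
  unfolding pointed_map_def
proof
  show "H1_map G S f \<in> H1 G Q \<rightarrow> H1 G S"
    by (auto elim!: H1E simp: H1_map_class compose_Z1 S.H1_class_in_H1)
  show "H1_map G S f (H1_base G Q) = H1_base G S"
    by (simp add: H1_base_def H1_map_class Q.trivial_Z1 compose_trivial)
qed

end

lemma compose_compose_eq:
  assumes "\<And>q. q \<in> carrier Q \<Longrightarrow> f' (f q) = k' (k q)" "\<gamma> \<in> Z1 G Q"
  shows "compose (carrier G) f' (compose (carrier G) f \<gamma>)
    = compose (carrier G) k' (compose (carrier G) k \<gamma>)"
  using assms by (auto simp: compose_def fun_eq_iff Z1_closed)

section \<open>Second cohomology with abelian coefficients\<close>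

lemma Z2_closed: "\<lbrakk>c \<in> Z2 G R; g \<in> carrier G; h \<in> carrier G\<rbrakk> \<Longrightarrow> c (g, h) \<in> carrier R"
  by (auto simp: Z2_def)

lemma Z2_cocycle:
  "\<lbrakk>c \<in> Z2 G R; g \<in> carrier G; h \<in> carrier G; k \<in> carrier G\<rbrakk>
    \<Longrightarrow> c (g \<otimes>\<^bsub>G\<^esub> h, k) \<otimes>\<^bsub>R\<^esub> c (g, h) \<triangleleft>\<^bsub>R\<^esub> k = c (g, h \<otimes>\<^bsub>G\<^esub> k) \<otimes>\<^bsub>R\<^esub> c (h, k)"
  by (auto simp: Z2_def)

lemma Z2I:
  "\<lbrakk>c \<in> extensional (carrier G \<times> carrier G);
    \<And>g h. \<lbrakk>g \<in> carrier G; h \<in> carrier G\<rbrakk> \<Longrightarrow> c (g, h) \<in> carrier R;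
    \<And>g h k. \<lbrakk>g \<in> carrier G; h \<in> carrier G; k \<in> carrier G\<rbrakk>
      \<Longrightarrow> c (g \<otimes>\<^bsub>G\<^esub> h, k) \<otimes>\<^bsub>R\<^esub> c (g, h) \<triangleleft>\<^bsub>R\<^esub> k = c (g, h \<otimes>\<^bsub>G\<^esub> k) \<otimes>\<^bsub>R\<^esub> c (h, k)\<rbrakk>
    \<Longrightarrow> c \<in> Z2 G R"
  by (auto simp: Z2_def PiE_def)

lemma H2_relI:
  "\<lbrakk>c \<in> Z2 G R; d \<in> Z2 G R; \<And>g. g \<in> carrier G \<Longrightarrow> \<phi> g \<in> carrier R;
    \<And>g h. \<lbrakk>g \<in> carrier G; h \<in> carrier G\<rbrakk> \<Longrightarrow>
      d (g, h) = c (g, h) \<otimes>\<^bsub>R\<^esub> \<phi> g \<triangleleft>\<^bsub>R\<^esub> h \<otimes>\<^bsub>R\<^esub> \<phi> h \<otimes>\<^bsub>R\<^esub> inv\<^bsub>R\<^esub> (\<phi> (g \<otimes>\<^bsub>G\<^esub> h))\<rbrakk>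
    \<Longrightarrow> (c, d) \<in> H2_rel G R"
  by (auto simp: H2_rel_def)

lemma H2_relE:
  assumes "(c, d) \<in> H2_rel G R"
  obtains \<phi> where "c \<in> Z2 G R" "d \<in> Z2 G R" "\<And>g. g \<in> carrier G \<Longrightarrow> \<phi> g \<in> carrier R"
    "\<And>g h. \<lbrakk>g \<in> carrier G; h \<in> carrier G\<rbrakk> \<Longrightarrow>
      d (g, h) = c (g, h) \<otimes>\<^bsub>R\<^esub> \<phi> g \<triangleleft>\<^bsub>R\<^esub> h \<otimes>\<^bsub>R\<^esub> \<phi> h \<otimes>\<^bsub>R\<^esub> inv\<^bsub>R\<^esub> (\<phi> (g \<otimes>\<^bsub>G\<^esub> h))"
proof -
  from assms obtain \<phi> where "c \<in> Z2 G R" "d \<in> Z2 G R" "\<phi> \<in> carrier G \<rightarrow> carrier R"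
    "\<forall>g\<in>carrier G. \<forall>h\<in>carrier G.
      d (g, h) = c (g, h) \<otimes>\<^bsub>R\<^esub> \<phi> g \<triangleleft>\<^bsub>R\<^esub> h \<otimes>\<^bsub>R\<^esub> \<phi> h \<otimes>\<^bsub>R\<^esub> inv\<^bsub>R\<^esub> (\<phi> (g \<otimes>\<^bsub>G\<^esub> h))"
    unfolding H2_rel_def by blast
  then show thesis by (intro that[of \<phi>]) auto
qed

lemma H2E:
  assumes "x \<in> H2 G R" obtains c where "c \<in> Z2 G R" "x = H2_class G R c"
  using assms by (auto simp: H2_def H2_class_def quotient_def)

locale comm_g_group = g_group G R + R: comm_group R
  for G :: "('g, 'x) monoid_scheme" and R :: "('r, 'g, 'y) ggrp_scheme"
begin

lemma trivial_Z2: "(\<lambda>p\<in>carrier G \<times> carrier G. \<one>\<^bsub>R\<^esub>) \<in> Z2 G R"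
  by (rule Z2I) auto

text \<open>Serves the symmetry of \<open>H2_rel\<close>: with x, y, z the values \<phi>(g)^h,
  \<phi>(h), \<phi>(gh), the coboundary of the pointwise inverse of \<open>\<phi>\<close> undoes
  that of \<open>\<phi>\<close>. Commutativity of R brings the inverse pairs together.\<close>

lemma coboundary_cancel:
  assumes "c \<in> carrier R" "x \<in> carrier R" "y \<in> carrier R" "z \<in> carrier R"
  shows "c \<otimes>\<^bsub>R\<^esub> x \<otimes>\<^bsub>R\<^esub> y \<otimes>\<^bsub>R\<^esub> inv\<^bsub>R\<^esub> z \<otimes>\<^bsub>R\<^esub> inv\<^bsub>R\<^esub> x \<otimes>\<^bsub>R\<^esub> inv\<^bsub>R\<^esub> y \<otimes>\<^bsub>R\<^esub> z = c"
proof -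
  have "c \<otimes>\<^bsub>R\<^esub> x \<otimes>\<^bsub>R\<^esub> y \<otimes>\<^bsub>R\<^esub> inv\<^bsub>R\<^esub> z \<otimes>\<^bsub>R\<^esub> inv\<^bsub>R\<^esub> x \<otimes>\<^bsub>R\<^esub> inv\<^bsub>R\<^esub> y \<otimes>\<^bsub>R\<^esub> z
    = c \<otimes>\<^bsub>R\<^esub> (x \<otimes>\<^bsub>R\<^esub> inv\<^bsub>R\<^esub> x) \<otimes>\<^bsub>R\<^esub> (y \<otimes>\<^bsub>R\<^esub> inv\<^bsub>R\<^esub> y) \<otimes>\<^bsub>R\<^esub> (z \<otimes>\<^bsub>R\<^esub> inv\<^bsub>R\<^esub> z)"
    using assms by (simp only: R.m_ac Q.m_closed Q.inv_closed)
  with assms show ?thesis by simp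
qed

lemma equiv_H2_rel: "equiv (Z2 G R) (H2_rel G R)"
proof (rule equivI)
  show "H2_rel G R \<subseteq> Z2 G R \<times> Z2 G R"
    by (auto simp: H2_rel_def)
  show "refl_on (Z2 G R) (H2_rel G R)"
    unfolding refl_on_def
    by (auto intro!: H2_relI[where \<phi> = "\<lambda>_. \<one>\<^bsub>R\<^esub>"] simp: Z2_closed)
  show "sym (H2_rel G R)"
  proof (rule symI)
    fix c d assume "(c, d) \<in> H2_rel G R"
    then obtain \<phi> where \<phi>: "c \<in> Z2 G R" "d \<in> Z2 G R" "\<And>g. g \<in> carrier G \<Longrightarrow> \<phi> g \<in> carrier R"
      "\<And>g h. \<lbrakk>g \<in> carrier G; h \<in> carrier G\<rbrakk> \<Longrightarrow>
        d (g, h) = c (g, h) \<otimes>\<^bsub>R\<^esub> \<phi> g \<triangleleft>\<^bsub>R\<^esub> h \<otimes>\<^bsub>R\<^esub> \<phi> h \<otimes>\<^bsub>R\<^esub> inv\<^bsub>R\<^esub> (\<phi> (g \<otimes>\<^bsub>G\<^esub> h))"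
      by (rule H2_relE) blast
    show "(d, c) \<in> H2_rel G R"
      by (rule H2_relI[where \<phi> = "\<lambda>g. inv\<^bsub>R\<^esub> (\<phi> g)"])
        (simp_all add: \<phi> Z2_closed[OF \<phi>(1)] inv_act coboundary_cancel)
  qed
  show "trans (H2_rel G R)"
  proof (rule transI)
    fix b c d assume "(b, c) \<in> H2_rel G R" "(c, d) \<in> H2_rel G R"
    then obtain \<phi> \<psi> where \<phi>: "b \<in> Z2 G R" "c \<in> Z2 G R" "\<And>g. g \<in> carrier G \<Longrightarrow> \<phi> g \<in> carrier R"
      "\<And>g h. \<lbrakk>g \<in> carrier G; h \<in> carrier G\<rbrakk> \<Longrightarrow>
        c (g, h) = b (g, h) \<otimes>\<^bsub>R\<^esub> \<phi> g \<triangleleft>\<^bsub>R\<^esub> h \<otimes>\<^bsub>R\<^esub> \<phi> h \<otimes>\<^bsub>R\<^esub> inv\<^bsub>R\<^esub> (\<phi> (g \<otimes>\<^bsub>G\<^esub> h))"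
      and \<psi>: "d \<in> Z2 G R" "\<And>g. g \<in> carrier G \<Longrightarrow> \<psi> g \<in> carrier R"
      "\<And>g h. \<lbrakk>g \<in> carrier G; h \<in> carrier G\<rbrakk> \<Longrightarrow>
        d (g, h) = c (g, h) \<otimes>\<^bsub>R\<^esub> \<psi> g \<triangleleft>\<^bsub>R\<^esub> h \<otimes>\<^bsub>R\<^esub> \<psi> h \<otimes>\<^bsub>R\<^esub> inv\<^bsub>R\<^esub> (\<psi> (g \<otimes>\<^bsub>G\<^esub> h))"
      by (elim H2_relE) blast
    \<comment> \<open>In an abelian group the coboundary of a pointwise product is the product of
      the coboundaries, so the witnesses multiply.\<close>
    show "(b, d) \<in> H2_rel G R"
      by (rule H2_relI[where \<phi> = "\<lambda>g. \<phi> g \<otimes>\<^bsub>R\<^esub> \<psi> g"])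
        (simp_all add: \<phi> \<psi> Z2_closed[OF \<phi>(1)] R.m_ac R.inv_mult act_distrib)
  qed
qed

lemma H2_class_eq_iff:
  "\<lbrakk>c \<in> Z2 G R; d \<in> Z2 G R\<rbrakk> \<Longrightarrow> H2_class G R c = H2_class G R d \<longleftrightarrow> (c, d) \<in> H2_rel G R"
  unfolding H2_class_def by (metis equiv_H2_rel eq_equiv_class_iff)

lemma H2_class_in_H2: "c \<in> Z2 G R \<Longrightarrow> H2_class G R c \<in> H2 G R"
  by (auto simp: H2_class_def H2_def quotientI)

end

section \<open>Maps in degree two induced by homomorphisms of abelian coefficients\<close>

locale comm_g_group_hom = R: comm_g_group G R + R': comm_g_group G R' + g_group_hom G R R' f
  for G :: "('g, 'x) monoid_scheme" and R :: "('r, 'g, 'y) ggrp_scheme"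
    and R' :: "('r1, 'g, 'z) ggrp_scheme" and f :: "'r \<Rightarrow> 'r1"
begin

lemma compose_Z2:
  assumes "c \<in> Z2 G R" shows "compose (carrier G \<times> carrier G) f c \<in> Z2 G R'"
proof (rule Z2I)
  fix g h k assume g: "g \<in> carrier G" "h \<in> carrier G" "k \<in> carrier G"
  show "compose (carrier G \<times> carrier G) f c (g \<otimes>\<^bsub>G\<^esub> h, k) \<otimes>\<^bsub>R'\<^esub>
      compose (carrier G \<times> carrier G) f c (g, h) \<triangleleft>\<^bsub>R'\<^esub> k =
    compose (carrier G \<times> carrier G) f c (g, h \<otimes>\<^bsub>G\<^esub> k) \<otimes>\<^bsub>R'\<^esub>
      compose (carrier G \<times> carrier G) f c (h, k)"
    using Z2_cocycle[OF assms g] g assms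
    by (simp add: compose_def Z2_closed hom_act[symmetric] hom_mult[symmetric] del: hom_mult)
qed (use assms in \<open>auto simp: compose_def Z2_closed\<close>)

lemma compose_H2_rel:
  assumes "(c, d) \<in> H2_rel G R"
  shows "(compose (carrier G \<times> carrier G) f c, compose (carrier G \<times> carrier G) f d) \<in> H2_rel G R'"
proof -
  from assms obtain \<phi> where \<phi>: "c \<in> Z2 G R" "d \<in> Z2 G R" "\<And>g. g \<in> carrier G \<Longrightarrow> \<phi> g \<in> carrier R"
      "\<And>g h. \<lbrakk>g \<in> carrier G; h \<in> carrier G\<rbrakk> \<Longrightarrow>
        d (g, h) = c (g, h) \<otimes>\<^bsub>R\<^esub> \<phi> g \<triangleleft>\<^bsub>R\<^esub> h \<otimes>\<^bsub>R\<^esub> \<phi> h \<otimes>\<^bsub>R\<^esub> inv\<^bsub>R\<^esub> (\<phi> (g \<otimes>\<^bsub>G\<^esub> h))"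
    by (rule H2_relE) blast
  show ?thesis
    by (rule H2_relI[where \<phi> = "\<lambda>g. f (\<phi> g)"])
      (simp_all add: compose_Z2 \<phi>(1-3),
        simp_all add: \<phi>(3,4) Z2_closed[OF \<phi>(1)] compose_def hom_act)
qed

lemma H2_map_class:
  assumes "c \<in> Z2 G R"
  shows "H2_map G R' f (H2_class G R c) = H2_class G R' (compose (carrier G \<times> carrier G) f c)"
proof -
  have "c \<in> H2_class G R c"
    using equiv_class_self[OF R.equiv_H2_rel assms] by (simp add: H2_class_def)
  moreover have "H2_class G R' (compose (carrier G \<times> carrier G) f d)
      = H2_class G R' (compose (carrier G \<times> carrier G) f c)" if "d \<in> H2_class G R c" for d
  proof -
    from that have "(c, d) \<in> H2_rel G R" "d \<in> Z2 G R"
      by (auto simp: H2_class_def H2_rel_def)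
    then show ?thesis
      using R'.H2_class_eq_iff assms compose_H2_rel compose_Z2 by metis
  qed
  ultimately show ?thesis
    unfolding H2_map_def by (metis (no_types, lifting) SUP_eq_const equals0D)
qed

lemma pointed_map_H2: "pointed_map (H2 G R) (H2_base G R) (H2 G R') (H2_base G R') (H2_map G R' f)"
  unfolding pointed_map_def
proof
  show "H2_map G R' f \<in> H2 G R \<rightarrow> H2 G R'"
    by (auto elim!: H2E simp: H2_map_class compose_Z2 R'.H2_class_in_H2)
  have "compose (carrier G \<times> carrier G) f (\<lambda>p\<in>carrier G \<times> carrier G. \<one>\<^bsub>R\<^esub>)
      = (\<lambda>p\<in>carrier G \<times> carrier G. \<one>\<^bsub>R'\<^esub>)"
    by (auto simp: compose_def fun_eq_iff)
  then show "H2_map G R' f (H2_base G R) = H2_base G R'"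
    by (simp add: H2_base_def H2_map_class R.trivial_Z2)
qed

end

section \<open>Central extensions\<close>

locale central_extension =
  fixes G :: "('g, 'x) monoid_scheme" and R :: "('r, 'g, 'u) ggrp_scheme"
    and Q :: "('q, 'g, 'v) ggrp_scheme" and S :: "('s, 'g, 'w) ggrp_scheme"
    and \<iota> :: "'r \<Rightarrow> 'q" and \<pi> :: "'q \<Rightarrow> 's" and \<sigma> :: "'s \<Rightarrow> 'q"
  assumes exact: "g_short_exact G R Q S \<iota> \<pi>"
    and image_central: "\<iota> ` carrier R \<subseteq> center Q"
    and set_section: "set_section Q S \<pi> \<sigma>"
begin

sublocale incl: g_group_hom G R Q \<iota>
  using exact by (simp add: g_short_exact_def g_group_hom_def g_group_hom_axioms_def)

sublocale proj: g_group_hom G Q S \<pi>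
  using exact by (simp add: g_short_exact_def g_group_hom_def g_group_hom_axioms_def)

lemma incl_eq_iff: "\<lbrakk>x \<in> carrier R; y \<in> carrier R\<rbrakk> \<Longrightarrow> \<iota> x = \<iota> y \<longleftrightarrow> x = y"
  using exact by (auto simp: g_short_exact_def inj_on_eq_iff)

lemma incl_commute: "\<lbrakk>r \<in> carrier R; q \<in> carrier Q\<rbrakk> \<Longrightarrow> \<iota> r \<otimes>\<^bsub>Q\<^esub> q = q \<otimes>\<^bsub>Q\<^esub> \<iota> r"
  using image_central by (auto simp: center_def)

text \<open>R is abelian because it embeds into the center of Q; this makes the theory of H^2
  available for it.\<close>

sublocale R: comm_g_group G R
proof (unfold_locales, goal_cases)
  case (1 x y)
  then show ?case
    using incl_commute[of x "\<iota> y"] by (simp flip: incl.hom_mult add: incl_eq_iff)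
qed

lemma proj_incl [simp]: "r \<in> carrier R \<Longrightarrow> \<pi> (\<iota> r) = \<one>\<^bsub>S\<^esub>"
  using exact by (auto simp: g_short_exact_def kernel_def)

lemma proj_lift: assumes "s \<in> carrier S" obtains q where "q \<in> carrier Q" "\<pi> q = s"
  using assms exact by (metis g_short_exact_def imageE)

lemma section_closed: "s \<in> carrier S \<Longrightarrow> \<sigma> s \<in> carrier Q"
  and proj_section: "s \<in> carrier S \<Longrightarrow> \<pi> (\<sigma> s) = s"
  using set_section by (auto simp: set_section_def)

lemma kernel_lift:
  assumes "q \<in> carrier Q" "\<pi> q = \<one>\<^bsub>S\<^esub>" obtains r where "r \<in> carrier R" "q = \<iota> r"
proof -
  have "q \<in> kernel Q S \<pi>" using assms by (simp add: kernel_def)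
  then show ?thesis using exact that by (metis g_short_exact_def imageE)
qed

lemma fibre_lift:
  assumes "p \<in> carrier Q" "q \<in> carrier Q" "\<pi> p = \<pi> q"
  obtains r where "r \<in> carrier R" "p = \<iota> r \<otimes>\<^bsub>Q\<^esub> q"
proof -
  have "p \<otimes>\<^bsub>Q\<^esub> inv\<^bsub>Q\<^esub> q \<in> carrier Q" "\<pi> (p \<otimes>\<^bsub>Q\<^esub> inv\<^bsub>Q\<^esub> q) = \<one>\<^bsub>S\<^esub>"
    using assms by simp_all
  then obtain r where "r \<in> carrier R" "p \<otimes>\<^bsub>Q\<^esub> inv\<^bsub>Q\<^esub> q = \<iota> r"
    by (rule kernel_lift)
  then show ?thesis
    using assms that by (metis incl.S.Q.inv_solve_right' incl.hom_closed)
qed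

lemma incl_cancel:
  "\<lbrakk>x \<in> carrier R; y \<in> carrier R; q \<in> carrier Q; \<iota> x \<otimes>\<^bsub>Q\<^esub> q = \<iota> y \<otimes>\<^bsub>Q\<^esub> q\<rbrakk> \<Longrightarrow> x = y"
  by (simp add: incl_eq_iff)

lemma incl_assoc:
  "\<lbrakk>x \<in> carrier R; y \<in> carrier R; q \<in> carrier Q\<rbrakk>
    \<Longrightarrow> \<iota> x \<otimes>\<^bsub>Q\<^esub> (\<iota> y \<otimes>\<^bsub>Q\<^esub> q) = \<iota> (x \<otimes>\<^bsub>R\<^esub> y) \<otimes>\<^bsub>Q\<^esub> q"
  by (simp add: incl.S.Q.m_assoc)

lemma incl_left_commute:
  "\<lbrakk>r \<in> carrier R; p \<in> carrier Q; q \<in> carrier Q\<rbrakk>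
    \<Longrightarrow> p \<otimes>\<^bsub>Q\<^esub> (\<iota> r \<otimes>\<^bsub>Q\<^esub> q) = \<iota> r \<otimes>\<^bsub>Q\<^esub> (p \<otimes>\<^bsub>Q\<^esub> q)"
  by (metis incl.S.Q.m_assoc incl.hom_closed incl_commute)

text \<open>Central factors collect in front of a product. This is what lets a pointwise product of
  an R-cocycle and a Q-cocycle satisfy the cocycle identity again.\<close>

lemma incl_interchange:
  assumes "x \<in> carrier R" "y \<in> carrier R" "p \<in> carrier Q" "q \<in> carrier Q"
  shows "(\<iota> x \<otimes>\<^bsub>Q\<^esub> p) \<otimes>\<^bsub>Q\<^esub> (\<iota> y \<otimes>\<^bsub>Q\<^esub> q) = \<iota> (x \<otimes>\<^bsub>R\<^esub> y) \<otimes>\<^bsub>Q\<^esub> (p \<otimes>\<^bsub>Q\<^esub> q)"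
proof -
  have "(\<iota> x \<otimes>\<^bsub>Q\<^esub> p) \<otimes>\<^bsub>Q\<^esub> (\<iota> y \<otimes>\<^bsub>Q\<^esub> q) = \<iota> x \<otimes>\<^bsub>Q\<^esub> (\<iota> y \<otimes>\<^bsub>Q\<^esub> (p \<otimes>\<^bsub>Q\<^esub> q))"
    using assms by (simp add: incl.S.Q.m_assoc incl_left_commute[of y p q])
  with assms show ?thesis by (simp add: incl_assoc)
qed

lemma act_incl_mult:
  "\<lbrakk>r \<in> carrier R; q \<in> carrier Q; g \<in> carrier G\<rbrakk>
    \<Longrightarrow> (\<iota> r \<otimes>\<^bsub>Q\<^esub> q) \<triangleleft>\<^bsub>Q\<^esub> g = \<iota> (r \<triangleleft>\<^bsub>R\<^esub> g) \<otimes>\<^bsub>Q\<^esub> q \<triangleleft>\<^bsub>Q\<^esub> g"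
  by (simp add: incl.S.act_distrib incl.hom_act)

section \<open>The action of R-cocycles on the Q-cocycles over a fixed S-cocycle\<close>

definition tw :: "('g \<Rightarrow> 'r) \<Rightarrow> ('g \<Rightarrow> 'q) \<Rightarrow> 'g \<Rightarrow> 'q"
  where "tw \<rho> \<gamma> = (\<lambda>g\<in>carrier G. \<iota> (\<rho> g) \<otimes>\<^bsub>Q\<^esub> \<gamma> g)"

lemma tw_Z1: "\<lbrakk>\<rho> \<in> Z1 G R; \<gamma> \<in> Z1 G Q\<rbrakk> \<Longrightarrow> tw \<rho> \<gamma> \<in> Z1 G Q"
  by (rule Z1I)
    (simp_all add: tw_def Z1_closed Z1_mult act_incl_mult incl_interchange del: incl.hom_mult)

lemma compose_proj_tw:
  "\<lbrakk>\<rho> \<in> Z1 G R; \<gamma> \<in> Z1 G Q\<rbrakk>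
    \<Longrightarrow> compose (carrier G) \<pi> (tw \<rho> \<gamma>) = compose (carrier G) \<pi> \<gamma>"
  by (rule extensionalityI[of _ "carrier G"]) (auto simp: tw_def compose_def Z1_closed)

lemma cob_tw:
  "\<lbrakk>\<rho> \<in> Z1 G R; \<gamma> \<in> Z1 G Q; q \<in> carrier Q\<rbrakk> \<Longrightarrow> cob G Q q (tw \<rho> \<gamma>) = tw \<rho> (cob G Q q \<gamma>)"
  by (rule extensionalityI[of _ "carrier G"])
    (auto simp: tw_def cob_def Z1_closed incl.S.Q.m_assoc incl_left_commute)

text \<open>Conjugation by a central element does not move \<open>\<gamma>\<close>, so the whole
  effect of \<open>\<iota> r\<close> falls on the R-factor. Coboundaries in R thereby become
  coboundary moves in Q, and conversely.\<close>

lemma cob_incl_tw: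
  assumes "\<rho> \<in> Z1 G R" "\<gamma> \<in> Z1 G Q" "r \<in> carrier R"
  shows "cob G Q (\<iota> r) (tw \<rho> \<gamma>) = tw (cob G R r \<rho>) \<gamma>"
proof (rule extensionalityI[of _ "carrier G"])
  fix g assume g: "g \<in> carrier G"
  note closed = Z1_closed[OF assms(1) g] Z1_closed[OF assms(2) g] assms(3) g
  have "cob G Q (\<iota> r) (tw \<rho> \<gamma>) g
    = \<iota> ((inv\<^bsub>R\<^esub> r) \<triangleleft>\<^bsub>R\<^esub> g) \<otimes>\<^bsub>Q\<^esub> (\<iota> (\<rho> g) \<otimes>\<^bsub>Q\<^esub> (\<gamma> g \<otimes>\<^bsub>Q\<^esub> \<iota> r))"
    using closed by (simp add: cob_def tw_def incl.S.Q.m_assoc incl.hom_act)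
  also have "\<gamma> g \<otimes>\<^bsub>Q\<^esub> \<iota> r = \<iota> r \<otimes>\<^bsub>Q\<^esub> \<gamma> g"
    using closed by (simp add: incl_commute)
  also have "\<iota> ((inv\<^bsub>R\<^esub> r) \<triangleleft>\<^bsub>R\<^esub> g) \<otimes>\<^bsub>Q\<^esub> (\<iota> (\<rho> g) \<otimes>\<^bsub>Q\<^esub> (\<iota> r \<otimes>\<^bsub>Q\<^esub> \<gamma> g)) = tw (cob G R r \<rho>) \<gamma> g"
    using closed by (simp add: cob_def tw_def incl_assoc incl.Q.Q.m_assoc del: incl.hom_mult)
  finally show "cob G Q (\<iota> r) (tw \<rho> \<gamma>) g = tw (cob G R r \<rho>) \<gamma> g" .
qed (simp_all add: tw_def)

text \<open>The action is free: \<open>\<gamma> g\<close> cancels on the right, and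
  \<open>\<iota>\<close> is injective. Equations between Q-cocycles can therefore be read back in
  R.\<close>

lemma tw_inject:
  assumes "\<rho> \<in> Z1 G R" "\<tau> \<in> Z1 G R" "\<gamma> \<in> Z1 G Q" "tw \<rho> \<gamma> = tw \<tau> \<gamma>"
  shows "\<rho> = \<tau>"
proof (rule Z1_eqI)
  fix g assume g: "g \<in> carrier G"
  then have "\<iota> (\<rho> g) \<otimes>\<^bsub>Q\<^esub> \<gamma> g = \<iota> (\<tau> g) \<otimes>\<^bsub>Q\<^esub> \<gamma> g"
    using fun_cong[OF assms(4), of g] by (simp add: tw_def)
  then show "\<rho> g = \<tau> g"
    using g assms by (metis Z1_closed incl_cancel)
qed (use assms in auto)

lemma tw_trivial: "\<rho> \<in> Z1 G R \<Longrightarrow> tw \<rho> (\<lambda>g\<in>carrier G. \<one>\<^bsub>Q\<^esub>) = compose (carrier G) \<iota> \<rho>"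
  by (auto simp: tw_def compose_def fun_eq_iff Z1_closed)

text \<open>Exactness supplies the values of \<open>\<rho>\<close> pointwise. Expanding \<delta>(gh)
  both directly and through the cocycle identity leaves the identity for \<open>\<rho>\<close> times
  the common factor \<gamma>(gh), which cancels.\<close>

lemma fibre_Z1:
  assumes \<gamma>: "\<gamma> \<in> Z1 G Q" and \<delta>: "\<delta> \<in> Z1 G Q"
    and eq: "compose (carrier G) \<pi> \<gamma> = compose (carrier G) \<pi> \<delta>"
  obtains \<rho> where "\<rho> \<in> Z1 G R" "\<delta> = tw \<rho> \<gamma>"
proof -
  have "\<exists>r\<in>carrier R. \<delta> g = \<iota> r \<otimes>\<^bsub>Q\<^esub> \<gamma> g" if g: "g \<in> carrier G" for g
  proof -
    have "\<pi> (\<delta> g) = \<pi> (\<gamma> g)"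
      using fun_cong[OF eq, of g] g by (simp add: compose_def)
    then show ?thesis
      using g \<gamma> \<delta> by (meson Z1_closed fibre_lift)
  qed
  then obtain \<rho>\<^sub>0 where \<rho>\<^sub>0: "\<And>g. g \<in> carrier G \<Longrightarrow> \<rho>\<^sub>0 g \<in> carrier R"
    "\<And>g. g \<in> carrier G \<Longrightarrow> \<delta> g = \<iota> (\<rho>\<^sub>0 g) \<otimes>\<^bsub>Q\<^esub> \<gamma> g"
    by metis
  \<comment> \<open>Cocycles are extensional, so the chosen values are cut off outside G.\<close>
  define \<rho> where "\<rho> = restrict \<rho>\<^sub>0 (carrier G)"
  have \<rho>: "\<And>g. g \<in> carrier G \<Longrightarrow> \<rho> g \<in> carrier R"
    "\<And>g. g \<in> carrier G \<Longrightarrow> \<delta> g = \<iota> (\<rho> g) \<otimes>\<^bsub>Q\<^esub> \<gamma> g"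
    by (auto simp: \<rho>_def \<rho>\<^sub>0)
  have "\<rho> \<in> Z1 G R"
  proof (rule Z1I)
    fix g h assume gh: "g \<in> carrier G" "h \<in> carrier G"
    note closed = gh \<rho>(1) Z1_closed[OF \<gamma>]
    have "\<iota> (\<rho> (g \<otimes>\<^bsub>G\<^esub> h)) \<otimes>\<^bsub>Q\<^esub> \<gamma> (g \<otimes>\<^bsub>G\<^esub> h) = \<delta> g \<triangleleft>\<^bsub>Q\<^esub> h \<otimes>\<^bsub>Q\<^esub> \<delta> h"
      using gh by (simp add: \<rho>(2)[symmetric] Z1_mult[OF \<delta>])
    also have "\<dots> = \<iota> (\<rho> g \<triangleleft>\<^bsub>R\<^esub> h \<otimes>\<^bsub>R\<^esub> \<rho> h) \<otimes>\<^bsub>Q\<^esub> \<gamma> (g \<otimes>\<^bsub>G\<^esub> h)"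
      using closed
      by (simp add: \<rho>(2) Z1_mult[OF \<gamma>] act_incl_mult incl_interchange del: incl.hom_mult)
    finally show "\<rho> (g \<otimes>\<^bsub>G\<^esub> h) = \<rho> g \<triangleleft>\<^bsub>R\<^esub> h \<otimes>\<^bsub>R\<^esub> \<rho> h"
      by (rule incl_cancel[rotated 3]) (use closed in auto)
  qed (auto simp: \<rho> \<rho>_def \<rho>\<^sub>0)
  moreover have "\<delta> = tw \<rho> \<gamma>"
    by (rule extensionalityI[of _ "carrier G"]) (auto simp: tw_def \<rho>(2) Z1_extensional[OF \<delta>])
  ultimately show ?thesis by (rule that)
qed

text \<open>Surjectivity of \<open>\<pi>\<close> lifts the coboundary move between the images to a
  move by an element of Q. After that move the images agree on the nose and \<open>fibre_Z1\<close>
  applies.\<close>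

lemma fibre_H1:
  assumes \<gamma>: "\<gamma> \<in> Z1 G Q" and \<delta>: "\<delta> \<in> Z1 G Q"
    and eq: "H1_class G S (compose (carrier G) \<pi> \<gamma>) = H1_class G S (compose (carrier G) \<pi> \<delta>)"
  obtains q \<rho> where "q \<in> carrier Q" "\<rho> \<in> Z1 G R" "\<delta> = tw \<rho> (cob G Q q \<gamma>)"
proof -
  obtain s where s: "s \<in> carrier S"
    "compose (carrier G) \<pi> \<delta> = cob G S s (compose (carrier G) \<pi> \<gamma>)"
    using eq \<gamma> \<delta> by (auto simp: proj.S.H1_class_eq_iff proj.compose_Z1)
  obtain q where q: "q \<in> carrier Q" "\<pi> q = s" using s(1) by (rule proj_lift)
  have "compose (carrier G) \<pi> (cob G Q q \<gamma>) = compose (carrier G) \<pi> \<delta>"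
    using s q \<gamma> by (simp add: proj.compose_cob Z1_closed)
  then obtain \<rho> where "\<rho> \<in> Z1 G R" "\<delta> = tw \<rho> (cob G Q q \<gamma>)"
    using fibre_Z1 \<delta> \<gamma> q(1) incl.S.cob_Z1 by metis
  with q show ?thesis using that by blast
qed

subsection \<open>The connecting map in degree zero\<close>

text \<open>A cocycle for the connecting map built from any lift of a fixed point, not just the one
  given by \<open>\<sigma>\<close>, so that independence of the lift can be stated.\<close>

definition bd :: "'q \<Rightarrow> 'g \<Rightarrow> 'r"
  where "bd q = (\<lambda>g\<in>carrier G. inv_into (carrier R) \<iota> ((inv\<^bsub>Q\<^esub> q) \<triangleleft>\<^bsub>Q\<^esub> g \<otimes>\<^bsub>Q\<^esub> q))"

lemma bd_lift:
  assumes q: "q \<in> carrier Q" "\<pi> q \<in> H0 G S" and g: "g \<in> carrier G"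
  shows "bd q g \<in> carrier R" "\<iota> (bd q g) = (inv\<^bsub>Q\<^esub> q) \<triangleleft>\<^bsub>Q\<^esub> g \<otimes>\<^bsub>Q\<^esub> q"
proof -
  have "\<pi> ((inv\<^bsub>Q\<^esub> q) \<triangleleft>\<^bsub>Q\<^esub> g \<otimes>\<^bsub>Q\<^esub> q) = \<one>\<^bsub>S\<^esub>"
    using q g by (simp add: proj.hom_act proj.S.inv_act H0_def)
  then obtain r where "r \<in> carrier R" "(inv\<^bsub>Q\<^esub> q) \<triangleleft>\<^bsub>Q\<^esub> g \<otimes>\<^bsub>Q\<^esub> q = \<iota> r"
    using q g by (metis kernel_lift incl.S.Q.inv_closed incl.S.Q.m_closed incl.S.act_closed)
  then have "(inv\<^bsub>Q\<^esub> q) \<triangleleft>\<^bsub>Q\<^esub> g \<otimes>\<^bsub>Q\<^esub> q \<in> \<iota> ` carrier R" by auto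
  then show "bd q g \<in> carrier R" "\<iota> (bd q g) = (inv\<^bsub>Q\<^esub> q) \<triangleleft>\<^bsub>Q\<^esub> g \<otimes>\<^bsub>Q\<^esub> q"
    using g by (auto simp: bd_def inv_into_into f_inv_into_f)
qed

lemma bd_Z1:
  assumes q: "q \<in> carrier Q" "\<pi> q \<in> H0 G S"
  shows "bd q \<in> Z1 G R"
proof (rule Z1I)
  fix g h assume gh: "g \<in> carrier G" "h \<in> carrier G"
  have "\<iota> (bd q (g \<otimes>\<^bsub>G\<^esub> h)) = \<iota> (bd q g \<triangleleft>\<^bsub>R\<^esub> h \<otimes>\<^bsub>R\<^esub> bd q h)"
    using gh q by (simp add: bd_lift incl.hom_act incl.S.word_simps)
  then show "bd q (g \<otimes>\<^bsub>G\<^esub> h) = bd q g \<triangleleft>\<^bsub>R\<^esub> h \<otimes>\<^bsub>R\<^esub> bd q h"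
    using gh q by (subst (asm) incl_eq_iff) (simp_all add: bd_lift(1))
qed (use bd_lift[OF q] in \<open>auto simp: bd_def\<close>)

lemma compose_incl_bd:
  "\<lbrakk>q \<in> carrier Q; \<pi> q \<in> H0 G S\<rbrakk>
    \<Longrightarrow> compose (carrier G) \<iota> (bd q) = cob G Q q (\<lambda>g\<in>carrier G. \<one>\<^bsub>Q\<^esub>)"
  by (rule extensionalityI[of _ "carrier G"]) (auto simp: compose_def cob_def bd_lift)

lemma bd_eqI:
  assumes "q \<in> carrier Q" "\<pi> q \<in> H0 G S" "\<rho> \<in> Z1 G R"
    and "compose (carrier G) \<iota> \<rho> = cob G Q q (\<lambda>g\<in>carrier G. \<one>\<^bsub>Q\<^esub>)"
  shows "bd q = \<rho>"
  by (rule tw_inject[OF bd_Z1[OF assms(1,2)] assms(3) incl.S.trivial_Z1])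
    (use assms in \<open>simp add: tw_trivial bd_Z1 compose_incl_bd\<close>)

lemma H0_closed: "s \<in> H0 G S \<Longrightarrow> s \<in> carrier S"
  by (simp add: H0_def)

text \<open>Two lifts of a fixed point differ by some \<open>\<iota> r\<close>, and this changes
  \<open>bd\<close> by the coboundary move of \<open>r\<close>. The section thus disappears from the
  class.\<close>

lemma conn0_eq:
  assumes q: "q \<in> carrier Q" "\<pi> q \<in> H0 G S"
  shows "conn0 G R Q \<iota> \<sigma> (\<pi> q) = H1_class G R (bd q)"
proof -
  define p where "p = \<sigma> (\<pi> q)"
  have p: "p \<in> carrier Q" "\<pi> p = \<pi> q"
    using q by (auto simp: p_def H0_closed section_closed proj_section)
  obtain r where r: "r \<in> carrier R" "q = \<iota> r \<otimes>\<^bsub>Q\<^esub> p"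
    using fibre_lift[OF q(1) p(1)] p(2) by metis
  have "compose (carrier G) \<iota> (cob G R r (bd p))
      = cob G Q (\<iota> r) (cob G Q p (\<lambda>g\<in>carrier G. \<one>\<^bsub>Q\<^esub>))"
    using r(1) p q bd_Z1[of p] by (simp add: incl.compose_cob compose_incl_bd Z1_closed)
  also have "\<dots> = cob G Q q (\<lambda>g\<in>carrier G. \<one>\<^bsub>Q\<^esub>)"
    using r p by (simp add: incl.S.cob_cob incl.S.trivial_Z1 incl_commute)
  finally have "bd q = cob G R r (bd p)"
    using q p r(1) by (intro bd_eqI) (auto simp: bd_Z1 incl.Q.cob_Z1)
  then have "H1_class G R (bd q) = H1_class G R (bd p)"
    using r(1) p q by (simp add: incl.Q.H1_class_cob bd_Z1)
  then show ?thesis by (simp add: conn0_def bd_def p_def)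
qed

lemma H0_lift:
  assumes "s \<in> H0 G S" obtains q where "q \<in> carrier Q" "\<pi> q = s" "\<pi> q \<in> H0 G S"
  using assms proj_lift by (metis H0_closed)

lemma pointed_map_conn0: "pointed_map (H0 G S) \<one>\<^bsub>S\<^esub> (H1 G R) (H1_base G R) (conn0 G R Q \<iota> \<sigma>)"
  unfolding pointed_map_def
proof
  show "conn0 G R Q \<iota> \<sigma> \<in> H0 G S \<rightarrow> H1 G R"
    by (metis H0_lift Pi_I bd_Z1 conn0_eq incl.Q.H1_class_in_H1)
  have one: "\<one>\<^bsub>S\<^esub> \<in> H0 G S" by (simp add: H0_def)
  have "bd \<one>\<^bsub>Q\<^esub> = (\<lambda>g\<in>carrier G. \<one>\<^bsub>R\<^esub>)"
    using one by (intro bd_eqI)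
      (simp_all add: incl.Q.trivial_Z1 incl.compose_trivial incl.S.cob_one incl.S.trivial_Z1)
  then show "conn0 G R Q \<iota> \<sigma> \<one>\<^bsub>S\<^esub> = H1_base G R"
    using conn0_eq[of "\<one>\<^bsub>Q\<^esub>"] one by (simp add: H1_base_def)
qed

section \<open>Exactness at H^1(G,R) and H^1(G,Q)\<close>

lemma exact_at_H1_kernel:
  "exact_at (H0 G S) (conn0 G R Q \<iota> \<sigma>) (H1 G R) (H1_map G Q \<iota>) (H1_base G Q)"
  unfolding exact_at_def
proof (intro equalityI subsetI)
  fix x assume "x \<in> conn0 G R Q \<iota> \<sigma> ` H0 G S"
  then obtain q where q: "q \<in> carrier Q" "\<pi> q \<in> H0 G S" "x = H1_class G R (bd q)"
    by (auto elim: H0_lift simp: conn0_eq)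
  then show "x \<in> {x \<in> H1 G R. H1_map G Q \<iota> x = H1_base G Q}"
    by (simp add: incl.Q.H1_class_in_H1 bd_Z1 incl.H1_map_class compose_incl_bd
        incl.S.H1_class_cob incl.S.trivial_Z1 H1_base_def)
next
  fix x assume "x \<in> {x \<in> H1 G R. H1_map G Q \<iota> x = H1_base G Q}"
  then obtain \<rho> where \<rho>: "\<rho> \<in> Z1 G R" "x = H1_class G R \<rho>"
    and base: "H1_map G Q \<iota> x = H1_base G Q"
    by (auto elim: H1E)
  then obtain q where q: "q \<in> carrier Q"
    "compose (carrier G) \<iota> \<rho> = cob G Q q (\<lambda>g\<in>carrier G. \<one>\<^bsub>Q\<^esub>)"
    by (metis H1_base_def incl.H1_map_class incl.S.H1_class_eq_iff incl.S.trivial_Z1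
        incl.compose_Z1)
  \<comment> \<open>\<open>\<pi>\<close> kills the values of \<open>\<iota>\<close> after
    \<open>\<rho>\<close>, so the coboundary of \<open>\<pi> q\<close> is trivial, which says that
    \<open>\<pi> q\<close> is fixed by G.\<close>
  have "\<pi> q \<in> H0 G S"
    unfolding H0_def
  proof (intro CollectI conjI ballI)
    fix g assume g: "g \<in> carrier G"
    then have "\<iota> (\<rho> g) = (inv\<^bsub>Q\<^esub> q) \<triangleleft>\<^bsub>Q\<^esub> g \<otimes>\<^bsub>Q\<^esub> q"
      using fun_cong[OF q(2), of g] q(1) by (simp add: compose_def cob_def)
    then have "\<pi> ((inv\<^bsub>Q\<^esub> q) \<triangleleft>\<^bsub>Q\<^esub> g \<otimes>\<^bsub>Q\<^esub> q) = \<one>\<^bsub>S\<^esub>"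
      using g \<rho>(1) by (metis Z1_closed proj_incl)
    then have "inv\<^bsub>S\<^esub> (\<pi> q \<triangleleft>\<^bsub>S\<^esub> g) \<otimes>\<^bsub>S\<^esub> \<pi> q = \<one>\<^bsub>S\<^esub>"
      using g q(1) by (simp add: proj.hom_act proj.S.inv_act)
    then show "\<pi> q \<triangleleft>\<^bsub>S\<^esub> g = \<pi> q"
      using g q(1) by (metis proj.S.Q.inv_closed proj.S.Q.inv_equality proj.S.Q.inv_inv
          proj.S.act_closed proj.hom_closed)
  qed (simp add: q)
  then have "conn0 G R Q \<iota> \<sigma> (\<pi> q) = x"
    using q \<rho> bd_eqI by (simp add: conn0_eq)
  with \<open>\<pi> q \<in> H0 G S\<close> show "x \<in> conn0 G R Q \<iota> \<sigma> ` H0 G S" by blast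
qed

lemma exact_at_H1_middle:
  "exact_at (H1 G R) (H1_map G Q \<iota>) (H1 G Q) (H1_map G S \<pi>) (H1_base G S)"
  unfolding exact_at_def
proof (intro equalityI subsetI)
  fix x assume "x \<in> H1_map G Q \<iota> ` H1 G R"
  then obtain \<rho> where \<rho>: "\<rho> \<in> Z1 G R" "x = H1_class G Q (compose (carrier G) \<iota> \<rho>)"
    by (auto elim!: H1E simp: incl.H1_map_class)
  have "compose (carrier G) \<pi> (compose (carrier G) \<iota> \<rho>) = (\<lambda>g\<in>carrier G. \<one>\<^bsub>S\<^esub>)"
    using \<rho>(1) by (auto simp: compose_def fun_eq_iff Z1_closed)
  with \<rho> show "x \<in> {x \<in> H1 G Q. H1_map G S \<pi> x = H1_base G S}"
    by (simp add: incl.S.H1_class_in_H1 proj.H1_map_class incl.compose_Z1 H1_base_def)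
next
  fix x assume "x \<in> {x \<in> H1 G Q. H1_map G S \<pi> x = H1_base G S}"
  then obtain \<gamma> where \<gamma>: "\<gamma> \<in> Z1 G Q" "x = H1_class G Q \<gamma>"
    and "H1_map G S \<pi> x = H1_base G S"
    by (auto elim: H1E)
  \<comment> \<open>The base point is the image of the trivial Q-cocycle, so \<open>\<gamma>\<close>
    lies in its fibre. Acting with \<open>\<rho>\<close> on the trivial cocycle gives
    \<open>\<iota>\<close> after \<open>\<rho>\<close>.\<close>
  then have "H1_class G S (compose (carrier G) \<pi> (\<lambda>g\<in>carrier G. \<one>\<^bsub>Q\<^esub>))
      = H1_class G S (compose (carrier G) \<pi> \<gamma>)"
    by (simp add: proj.H1_map_class H1_base_def proj.compose_trivial)
  then obtain q \<rho> where q: "q \<in> carrier Q" "\<rho> \<in> Z1 G R"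
    "\<gamma> = tw \<rho> (cob G Q q (\<lambda>g\<in>carrier G. \<one>\<^bsub>Q\<^esub>))"
    using fibre_H1 \<gamma>(1) incl.S.trivial_Z1 by metis
  then have "\<gamma> = cob G Q q (compose (carrier G) \<iota> \<rho>)"
    by (simp add: cob_tw[symmetric] incl.S.trivial_Z1 tw_trivial)
  then have "x = H1_map G Q \<iota> (H1_class G R \<rho>)"
    using q \<gamma> by (simp add: incl.H1_map_class incl.S.H1_class_cob incl.compose_Z1)
  with q show "x \<in> H1_map G Q \<iota> ` H1 G R"
    by (simp add: incl.Q.H1_class_in_H1)
qed

subsection \<open>The connecting map in degree one\<close>

text \<open>A lift is only a cochain, with no condition outside G, so that \<open>\<sigma>\<close>
  after a cocycle qualifies.\<close>

definition lifts :: "('g \<Rightarrow> 'q) \<Rightarrow> ('g \<Rightarrow> 's) \<Rightarrow> bool"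
  where "lifts a \<gamma> \<longleftrightarrow> (\<forall>g\<in>carrier G. a g \<in> carrier Q \<and> \<pi> (a g) = \<gamma> g)"

lemma lifts_closed: "\<lbrakk>lifts a \<gamma>; g \<in> carrier G\<rbrakk> \<Longrightarrow> a g \<in> carrier Q"
  and lifts_proj: "\<lbrakk>lifts a \<gamma>; g \<in> carrier G\<rbrakk> \<Longrightarrow> \<pi> (a g) = \<gamma> g"
  by (auto simp: lifts_def)

text \<open>Taken for an arbitrary lift, so that it can be evaluated on whichever lift is
  convenient: a Q-cocycle, a coboundary move of another lift, or the image of a lift under
  \<open>\<eta>\<close>.\<close>

definition obs :: "('g \<Rightarrow> 'q) \<Rightarrow> 'g \<times> 'g \<Rightarrow> 'r"
  where "obs a = (\<lambda>(g, h)\<in>carrier G \<times> carrier G.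
    inv_into (carrier R) \<iota> (a g \<triangleleft>\<^bsub>Q\<^esub> h \<otimes>\<^bsub>Q\<^esub> a h \<otimes>\<^bsub>Q\<^esub> inv\<^bsub>Q\<^esub> (a (g \<otimes>\<^bsub>G\<^esub> h))))"

lemma obs_lift:
  assumes \<gamma>: "\<gamma> \<in> Z1 G S" and a: "lifts a \<gamma>" and gh: "g \<in> carrier G" "h \<in> carrier G"
  shows obs_closed: "obs a (g, h) \<in> carrier R"
    and obs_mult: "\<iota> (obs a (g, h)) \<otimes>\<^bsub>Q\<^esub> a (g \<otimes>\<^bsub>G\<^esub> h) = a g \<triangleleft>\<^bsub>Q\<^esub> h \<otimes>\<^bsub>Q\<^esub> a h"
proof -
  let ?q = "a g \<triangleleft>\<^bsub>Q\<^esub> h \<otimes>\<^bsub>Q\<^esub> a h \<otimes>\<^bsub>Q\<^esub> inv\<^bsub>Q\<^esub> (a (g \<otimes>\<^bsub>G\<^esub> h))"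
  note closed = gh lifts_closed[OF a]
  have q: "?q \<in> carrier Q" using closed by simp
  have "\<pi> ?q = \<gamma> g \<triangleleft>\<^bsub>S\<^esub> h \<otimes>\<^bsub>S\<^esub> \<gamma> h \<otimes>\<^bsub>S\<^esub> inv\<^bsub>S\<^esub> (\<gamma> (g \<otimes>\<^bsub>G\<^esub> h))"
    using closed by (simp add: lifts_proj[OF a] proj.hom_act)
  also have "\<dots> = \<one>\<^bsub>S\<^esub>"
    using gh Z1_closed[OF \<gamma>] by (simp add: Z1_mult[OF \<gamma>])
  finally have "?q \<in> \<iota> ` carrier R"
    using q by (metis imageI kernel_lift)
  then have "obs a (g, h) \<in> carrier R \<and> \<iota> (obs a (g, h)) = ?q"
    using gh by (auto simp: obs_def inv_into_into f_inv_into_f)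
  then show "obs a (g, h) \<in> carrier R"
    "\<iota> (obs a (g, h)) \<otimes>\<^bsub>Q\<^esub> a (g \<otimes>\<^bsub>G\<^esub> h) = a g \<triangleleft>\<^bsub>Q\<^esub> h \<otimes>\<^bsub>Q\<^esub> a h"
    using closed by (simp_all add: incl.S.Q.m_assoc)
qed

lemma obs_eqI:
  assumes "\<gamma> \<in> Z1 G S" "lifts a \<gamma>" "g \<in> carrier G" "h \<in> carrier G" "r \<in> carrier R"
    and "\<iota> r \<otimes>\<^bsub>Q\<^esub> a (g \<otimes>\<^bsub>G\<^esub> h) = a g \<triangleleft>\<^bsub>Q\<^esub> h \<otimes>\<^bsub>Q\<^esub> a h"
  shows "obs a (g, h) = r"
  by (rule incl_cancel[of _ _ "a (g \<otimes>\<^bsub>G\<^esub> h)"])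
    (use assms in \<open>simp_all add: obs_closed obs_mult lifts_closed\<close>)

text \<open>Multiplied by a(ghk), both sides of the cocycle identity become a(g)^{hk} a(h)^k a(k),
  bracketed in two ways. Centrality moves the obstruction at (h,k) past the factor
  a(g)^{hk}.\<close>

lemma obs_Z2:
  assumes \<gamma>: "\<gamma> \<in> Z1 G S" and a: "lifts a \<gamma>"
  shows "obs a \<in> Z2 G R"
proof (rule Z2I)
  fix g h k assume ghk: "g \<in> carrier G" "h \<in> carrier G" "k \<in> carrier G"
  note closed = ghk lifts_closed[OF a] obs_closed[OF \<gamma> a]
  let ?a = "a (g \<otimes>\<^bsub>G\<^esub> h \<otimes>\<^bsub>G\<^esub> k)"
  have "\<iota> (obs a (g \<otimes>\<^bsub>G\<^esub> h, k) \<otimes>\<^bsub>R\<^esub> obs a (g, h) \<triangleleft>\<^bsub>R\<^esub> k) \<otimes>\<^bsub>Q\<^esub> ?a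
    = \<iota> (obs a (g, h) \<triangleleft>\<^bsub>R\<^esub> k) \<otimes>\<^bsub>Q\<^esub> (\<iota> (obs a (g \<otimes>\<^bsub>G\<^esub> h, k)) \<otimes>\<^bsub>Q\<^esub> ?a)"
    using closed by (simp add: incl_assoc R.R.m_comm del: incl.hom_mult)
  also have "\<dots> = (\<iota> (obs a (g, h)) \<otimes>\<^bsub>Q\<^esub> a (g \<otimes>\<^bsub>G\<^esub> h)) \<triangleleft>\<^bsub>Q\<^esub> k \<otimes>\<^bsub>Q\<^esub> a k"
    using closed by (simp add: obs_mult[OF \<gamma> a, of _ k] act_incl_mult incl.S.Q.m_assoc)
  also have "\<dots> = a g \<triangleleft>\<^bsub>Q\<^esub> (h \<otimes>\<^bsub>G\<^esub> k) \<otimes>\<^bsub>Q\<^esub> (\<iota> (obs a (h, k)) \<otimes>\<^bsub>Q\<^esub> a (h \<otimes>\<^bsub>G\<^esub> k))"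
    using closed by (simp add: obs_mult[OF \<gamma> a] incl.S.word_simps)
  also have "\<dots> = \<iota> (obs a (h, k)) \<otimes>\<^bsub>Q\<^esub> (a g \<triangleleft>\<^bsub>Q\<^esub> (h \<otimes>\<^bsub>G\<^esub> k) \<otimes>\<^bsub>Q\<^esub> a (h \<otimes>\<^bsub>G\<^esub> k))"
    using closed by (intro incl_left_commute) auto
  also have "\<dots> = \<iota> (obs a (h, k)) \<otimes>\<^bsub>Q\<^esub> (\<iota> (obs a (g, h \<otimes>\<^bsub>G\<^esub> k)) \<otimes>\<^bsub>Q\<^esub> ?a)"
    using closed obs_mult[OF \<gamma> a, of g "h \<otimes>\<^bsub>G\<^esub> k"] by (simp add: incl.Q.G.m_assoc)
  also have "\<dots> = \<iota> (obs a (g, h \<otimes>\<^bsub>G\<^esub> k) \<otimes>\<^bsub>R\<^esub> obs a (h, k)) \<otimes>\<^bsub>Q\<^esub> ?a"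
    using closed by (simp add: incl_assoc R.R.m_comm del: incl.hom_mult)
  finally show "obs a (g \<otimes>\<^bsub>G\<^esub> h, k) \<otimes>\<^bsub>R\<^esub> obs a (g, h) \<triangleleft>\<^bsub>R\<^esub> k
      = obs a (g, h \<otimes>\<^bsub>G\<^esub> k) \<otimes>\<^bsub>R\<^esub> obs a (h, k)"
    by (rule incl_cancel[rotated 3]) (use closed in auto)
qed (auto simp: obs_closed[OF \<gamma> a], simp add: obs_def)

text \<open>The right-hand side has the shape required by \<open>H2_rel\<close>: the factor
  \<open>\<phi>\<close> by which two lifts of one cocycle differ is itself the witness that their
  obstructions are cohomologous.\<close>

lemma obs_incl_mult:
  assumes \<gamma>: "\<gamma> \<in> Z1 G S" and a: "lifts a \<gamma>" and b: "lifts b \<gamma>"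
    and \<phi>: "\<And>g. g \<in> carrier G \<Longrightarrow> \<phi> g \<in> carrier R"
    and eq: "\<And>g. g \<in> carrier G \<Longrightarrow> b g = \<iota> (\<phi> g) \<otimes>\<^bsub>Q\<^esub> a g"
    and gh: "g \<in> carrier G" "h \<in> carrier G"
  shows "obs b (g, h)
    = obs a (g, h) \<otimes>\<^bsub>R\<^esub> \<phi> g \<triangleleft>\<^bsub>R\<^esub> h \<otimes>\<^bsub>R\<^esub> \<phi> h \<otimes>\<^bsub>R\<^esub> inv\<^bsub>R\<^esub> (\<phi> (g \<otimes>\<^bsub>G\<^esub> h))"
proof (rule obs_eqI[OF \<gamma> b gh])
  note closed = gh \<phi> lifts_closed[OF a] obs_closed[OF \<gamma> a]
  let ?x = "obs a (g, h) \<otimes>\<^bsub>R\<^esub> \<phi> g \<triangleleft>\<^bsub>R\<^esub> h \<otimes>\<^bsub>R\<^esub> \<phi> h"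
  let ?c = "?x \<otimes>\<^bsub>R\<^esub> inv\<^bsub>R\<^esub> (\<phi> (g \<otimes>\<^bsub>G\<^esub> h))"
  show "?c \<in> carrier R"
    using closed by simp
  have "\<iota> ?c \<otimes>\<^bsub>Q\<^esub> b (g \<otimes>\<^bsub>G\<^esub> h) = \<iota> (?c \<otimes>\<^bsub>R\<^esub> \<phi> (g \<otimes>\<^bsub>G\<^esub> h)) \<otimes>\<^bsub>Q\<^esub> a (g \<otimes>\<^bsub>G\<^esub> h)"
    using closed by (simp add: eq incl_assoc del: incl.hom_mult)
  also have "?c \<otimes>\<^bsub>R\<^esub> \<phi> (g \<otimes>\<^bsub>G\<^esub> h) = \<phi> g \<triangleleft>\<^bsub>R\<^esub> h \<otimes>\<^bsub>R\<^esub> \<phi> h \<otimes>\<^bsub>R\<^esub> obs a (g, h)"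
    using closed
    by (simp add: incl.Q.Q.m_assoc R.R.m_comm R.R.m_lcomm incl.Q.mult_inv_cancel)
  also have "\<iota> \<dots> \<otimes>\<^bsub>Q\<^esub> a (g \<otimes>\<^bsub>G\<^esub> h)
      = \<iota> (\<phi> g \<triangleleft>\<^bsub>R\<^esub> h \<otimes>\<^bsub>R\<^esub> \<phi> h) \<otimes>\<^bsub>Q\<^esub> (\<iota> (obs a (g, h)) \<otimes>\<^bsub>Q\<^esub> a (g \<otimes>\<^bsub>G\<^esub> h))"
    using closed by (simp add: incl_assoc del: incl.hom_mult)
  also have "\<dots> = b g \<triangleleft>\<^bsub>Q\<^esub> h \<otimes>\<^bsub>Q\<^esub> b h"
    using closed
    by (simp add: obs_mult[OF \<gamma> a] eq act_incl_mult incl_interchange del: incl.hom_mult)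
  finally show "\<iota> ?c \<otimes>\<^bsub>Q\<^esub> b (g \<otimes>\<^bsub>G\<^esub> h) = b g \<triangleleft>\<^bsub>Q\<^esub> h \<otimes>\<^bsub>Q\<^esub> b h" .
qed

lemma H2_class_obs_cong:
  assumes \<gamma>: "\<gamma> \<in> Z1 G S" and a: "lifts a \<gamma>" and b: "lifts b \<gamma>"
  shows "H2_class G R (obs a) = H2_class G R (obs b)"
proof -
  have "\<exists>r\<in>carrier R. b g = \<iota> r \<otimes>\<^bsub>Q\<^esub> a g" if "g \<in> carrier G" for g
    using that a b by (metis fibre_lift lifts_closed lifts_proj)
  then obtain \<phi> where \<phi>: "\<And>g. g \<in> carrier G \<Longrightarrow> \<phi> g \<in> carrier R"
    "\<And>g. g \<in> carrier G \<Longrightarrow> b g = \<iota> (\<phi> g) \<otimes>\<^bsub>Q\<^esub> a g"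
    by metis
  have "(obs a, obs b) \<in> H2_rel G R"
    by (rule H2_relI[where \<phi> = \<phi>])
      (use obs_Z2[OF \<gamma>] a b \<phi>(1) obs_incl_mult[OF \<gamma> a b \<phi>] in auto)
  then show ?thesis
    using R.H2_class_eq_iff obs_Z2[OF \<gamma>] a b by blast
qed

lemma lifts_cob:
  assumes "lifts a \<gamma>" "q \<in> carrier Q"
  shows "lifts (cob G Q q a) (cob G S (\<pi> q) \<gamma>)"
  using assms by (auto simp: lifts_def cob_def proj.hom_act)

text \<open>The moved lift lies over a different S-cocycle, yet its obstruction is the same function
  and not merely cohomologous. The inner occurrences of \<open>q\<close> cancel, and the central
  obstruction passes the outer ones.\<close>

lemma obs_cob:
  assumes \<gamma>: "\<gamma> \<in> Z1 G S" and a: "lifts a \<gamma>" and q: "q \<in> carrier Q"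
  shows "obs (cob G Q q a) = obs a"
proof (rule extensionalityI[of _ "carrier G \<times> carrier G"])
  fix p assume "p \<in> carrier G \<times> carrier G"
  then obtain g h where p: "p = (g, h)" and gh: "g \<in> carrier G" "h \<in> carrier G" by auto
  note closed = gh q lifts_closed[OF a] obs_closed[OF \<gamma> a]
  have "obs (cob G Q q a) (g, h) = obs a (g, h)"
  proof (rule obs_eqI[OF _ lifts_cob[OF a q] gh])
    show "cob G S (\<pi> q) \<gamma> \<in> Z1 G S"
      using \<gamma> q by (simp add: proj.S.cob_Z1)
    show "\<iota> (obs a (g, h)) \<otimes>\<^bsub>Q\<^esub> cob G Q q a (g \<otimes>\<^bsub>G\<^esub> h)
      = cob G Q q a g \<triangleleft>\<^bsub>Q\<^esub> h \<otimes>\<^bsub>Q\<^esub> cob G Q q a h"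
    proof -
      have "\<iota> (obs a (g, h)) \<otimes>\<^bsub>Q\<^esub> cob G Q q a (g \<otimes>\<^bsub>G\<^esub> h) =
        (inv\<^bsub>Q\<^esub> q) \<triangleleft>\<^bsub>Q\<^esub> (g \<otimes>\<^bsub>G\<^esub> h) \<otimes>\<^bsub>Q\<^esub> (\<iota> (obs a (g, h)) \<otimes>\<^bsub>Q\<^esub> a (g \<otimes>\<^bsub>G\<^esub> h)) \<otimes>\<^bsub>Q\<^esub> q"
        using closed
        by (simp add: cob_def incl.S.Q.m_assoc incl_left_commute[of "obs a (g, h)"])
      also have "\<dots> = cob G Q q a g \<triangleleft>\<^bsub>Q\<^esub> h \<otimes>\<^bsub>Q\<^esub> cob G Q q a h"
        using closed by (simp add: obs_mult[OF \<gamma> a] cob_def incl.S.word_simps)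
      finally show ?thesis .
    qed
  qed (use closed in simp)
  with p show "obs (cob G Q q a) p = obs a p" by simp
qed (simp_all add: obs_def)

lemma lifts_section: "\<gamma> \<in> Z1 G S \<Longrightarrow> lifts (\<lambda>g. \<sigma> (\<gamma> g)) \<gamma>"
  by (auto simp: lifts_def section_closed proj_section Z1_closed)

text \<open>For another representative \<open>\<delta>\<close> of the class, the lift given by
  \<open>\<sigma>\<close> and a coboundary move of \<open>a\<close> both lie over
  \<open>\<delta>\<close>. Their obstructions are cohomologous, and the second equals that of
  \<open>a\<close>.\<close>

lemma conn1_eq:
  assumes \<gamma>: "\<gamma> \<in> Z1 G S" and a: "lifts a \<gamma>"
  shows "conn1 G R Q \<iota> \<sigma> (H1_class G S \<gamma>) = H2_class G R (obs a)"
proof -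
  have "\<gamma> \<in> H1_class G S \<gamma>"
    using \<gamma> by (metis proj.S.Q.one_closed proj.S.cob_one proj.S.mem_H1_class_iff)
  moreover have "H2_class G R (obs (\<lambda>g. \<sigma> (\<delta> g))) = H2_class G R (obs a)"
    if mem: "\<delta> \<in> H1_class G S \<gamma>" for \<delta>
  proof -
    obtain s where s: "s \<in> carrier S" "\<delta> = cob G S s \<gamma>"
      using mem \<gamma> by (auto simp: proj.S.mem_H1_class_iff)
    then obtain q where q: "q \<in> carrier Q" "\<pi> q = s" by (metis proj_lift)
    have \<delta>: "\<delta> \<in> Z1 G S" using s \<gamma> by (simp add: proj.S.cob_Z1)
    have "lifts (cob G Q q a) \<delta>" using lifts_cob[OF a q(1)] q s by simp
    then have "H2_class G R (obs (\<lambda>g. \<sigma> (\<delta> g))) = H2_class G R (obs (cob G Q q a))"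
      by (rule H2_class_obs_cong[OF \<delta> lifts_section[OF \<delta>]])
    then show ?thesis by (simp add: obs_cob[OF \<gamma> a q(1)])
  qed
  ultimately have "(\<Union>\<delta>\<in>H1_class G S \<gamma>. H2_class G R (obs (\<lambda>g. \<sigma> (\<delta> g)))) = H2_class G R (obs a)"
    by (metis (no_types, lifting) SUP_eq_const equals0D)
  then show ?thesis by (simp add: conn1_def obs_def)
qed

lemma lifts_Z1: "\<gamma> \<in> Z1 G Q \<Longrightarrow> lifts \<gamma> (compose (carrier G) \<pi> \<gamma>)"
  by (auto simp: lifts_def compose_def Z1_closed)

lemma obs_Z1:
  assumes "\<gamma> \<in> Z1 G Q"
  shows "obs \<gamma> = (\<lambda>p\<in>carrier G \<times> carrier G. \<one>\<^bsub>R\<^esub>)"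
proof (rule extensionalityI[of _ "carrier G \<times> carrier G"])
  fix p assume "p \<in> carrier G \<times> carrier G"
  then obtain g h where p: "p = (g, h)" and gh: "g \<in> carrier G" "h \<in> carrier G" by auto
  have "obs \<gamma> (g, h) = \<one>\<^bsub>R\<^esub>"
    by (rule obs_eqI[OF proj.compose_Z1[OF assms] lifts_Z1[OF assms] gh])
      (use gh Z1_closed[OF assms] Z1_mult[OF assms] in auto)
  with p gh show "obs \<gamma> p = (\<lambda>p\<in>carrier G \<times> carrier G. \<one>\<^bsub>R\<^esub>) p" by simp
qed (simp_all add: obs_def)

lemma conn1_proj:
  assumes "\<gamma> \<in> Z1 G Q"
  shows "conn1 G R Q \<iota> \<sigma> (H1_class G S (compose (carrier G) \<pi> \<gamma>)) = H2_base G R"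
  using conn1_eq[OF proj.compose_Z1[OF assms] lifts_Z1[OF assms]]
  by (simp add: obs_Z1[OF assms] H2_base_def)

lemma pointed_map_conn1:
  "pointed_map (H1 G S) (H1_base G S) (H2 G R) (H2_base G R) (conn1 G R Q \<iota> \<sigma>)"
  unfolding pointed_map_def
proof
  show "conn1 G R Q \<iota> \<sigma> \<in> H1 G S \<rightarrow> H2 G R"
    by (auto elim!: H1E simp: conn1_eq[OF _ lifts_section] R.H2_class_in_H2 obs_Z2 lifts_section)
  show "conn1 G R Q \<iota> \<sigma> (H1_base G S) = H2_base G R"
    using conn1_proj[OF incl.S.trivial_Z1] by (simp add: proj.compose_trivial H1_base_def)
qed

lemma obs_eq_coboundary_lift:
  assumes \<gamma>: "\<gamma> \<in> Z1 G S" and a: "lifts a \<gamma>" and base: "H2_class G R (obs a) = H2_base G R"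
  obtains \<delta> where "\<delta> \<in> Z1 G Q" "compose (carrier G) \<pi> \<delta> = \<gamma>"
proof -
  have "(obs a, \<lambda>p\<in>carrier G \<times> carrier G. \<one>\<^bsub>R\<^esub>) \<in> H2_rel G R"
    using base R.H2_class_eq_iff[OF obs_Z2[OF \<gamma> a] R.trivial_Z2] by (simp add: H2_base_def)
  then obtain \<phi> where \<phi>: "\<And>g. g \<in> carrier G \<Longrightarrow> \<phi> g \<in> carrier R"
    "\<And>g h. \<lbrakk>g \<in> carrier G; h \<in> carrier G\<rbrakk> \<Longrightarrow>
      (\<lambda>p\<in>carrier G \<times> carrier G. \<one>\<^bsub>R\<^esub>) (g, h) = obs a (g, h) \<otimes>\<^bsub>R\<^esub> \<phi> g \<triangleleft>\<^bsub>R\<^esub> h \<otimes>\<^bsub>R\<^esub> \<phi> h \<otimes>\<^bsub>R\<^esub> inv\<^bsub>R\<^esub> (\<phi> (g \<otimes>\<^bsub>G\<^esub> h))"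
    by (rule H2_relE) blast
  \<comment> \<open>The cochain that trivialises the obstruction is the correction of the lift:
    multiplying by it makes the obstruction 1, which is the cocycle identity.\<close>
  define \<delta> where "\<delta> = tw \<phi> a"
  have \<delta>: "lifts \<delta> \<gamma>"
    using a \<phi>(1) Z1_closed[OF \<gamma>] by (auto simp: \<delta>_def tw_def lifts_def)
  have "\<delta> \<in> Z1 G Q"
  proof (rule Z1I)
    fix g h assume gh: "g \<in> carrier G" "h \<in> carrier G"
    have "obs \<delta> (g, h) = \<one>\<^bsub>R\<^esub>"
      using obs_incl_mult[where \<phi> = \<phi>, OF \<gamma> a \<delta> \<phi>(1) _ gh] \<phi>(2)[OF gh] gh by (simp add: \<delta>_def tw_def)
    then show "\<delta> (g \<otimes>\<^bsub>G\<^esub> h) = \<delta> g \<triangleleft>\<^bsub>Q\<^esub> h \<otimes>\<^bsub>Q\<^esub> \<delta> h"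
      using obs_mult[OF \<gamma> \<delta> gh] gh lifts_closed[OF \<delta>] by simp
  qed (use lifts_closed[OF \<delta>] in \<open>auto simp: \<delta>_def tw_def\<close>)
  moreover have "compose (carrier G) \<pi> \<delta> = \<gamma>"
    using \<delta> Z1_extensional[OF \<gamma>]
    by (intro extensionalityI[of _ "carrier G"]) (auto simp: lifts_def compose_def)
  ultimately show ?thesis by (rule that)
qed

lemma exact_at_H1_quotient:
  "exact_at (H1 G Q) (H1_map G S \<pi>) (H1 G S) (conn1 G R Q \<iota> \<sigma>) (H2_base G R)"
  unfolding exact_at_def
proof (intro equalityI subsetI)
  fix x assume "x \<in> H1_map G S \<pi> ` H1 G Q"
  then show "x \<in> {x \<in> H1 G S. conn1 G R Q \<iota> \<sigma> x = H2_base G R}"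
    by (auto elim!: H1E
        simp: proj.H1_map_class proj.S.H1_class_in_H1 proj.compose_Z1 conn1_proj)
next
  fix x assume "x \<in> {x \<in> H1 G S. conn1 G R Q \<iota> \<sigma> x = H2_base G R}"
  then obtain \<gamma> where \<gamma>: "\<gamma> \<in> Z1 G S" "x = H1_class G S \<gamma>"
    "H2_class G R (obs (\<lambda>g. \<sigma> (\<gamma> g))) = H2_base G R"
    by (auto elim!: H1E simp: conn1_eq[OF _ lifts_section])
  then obtain \<delta> where "\<delta> \<in> Z1 G Q" "compose (carrier G) \<pi> \<delta> = \<gamma>"
    by (metis lifts_section obs_eq_coboundary_lift)
  with \<gamma> show "x \<in> H1_map G S \<pi> ` H1 G Q"
    by (metis image_eqI incl.S.H1_class_in_H1 proj.H1_map_class)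
qed

lemma exact_row: "exact_row G R Q S \<iota> \<pi> \<sigma>"
  unfolding exact_row_def
  by (intro conjI pointed_map_conn0 incl.pointed_map_H1 proj.pointed_map_H1 pointed_map_conn1
      exact_at_H1_kernel exact_at_H1_middle exact_at_H1_quotient)

end

section \<open>Morphisms of central extensions\<close>

lemma mem_H0_twist_iff:
  "s \<in> H0 G (twist S \<gamma>) \<longleftrightarrow> s \<in> carrier S \<and>
    (\<forall>g\<in>carrier G. inv\<^bsub>S\<^esub> (\<gamma> g) \<otimes>\<^bsub>S\<^esub> s \<triangleleft>\<^bsub>S\<^esub> g \<otimes>\<^bsub>S\<^esub> \<gamma> g = s)"
  by (auto simp: H0_def twist_def)

text \<open>Both conditions rearrange to s^g \<gamma>(g) = \<gamma>(g) s. The fixed points of the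
  twisted group thus form the stabiliser of \<open>\<gamma>\<close> under coboundary moves.\<close>

lemma (in g_group) mem_H0_twist_iff_cob:
  assumes \<gamma>: "\<gamma> \<in> Z1 G Q" and s: "s \<in> carrier Q"
  shows "s \<in> H0 G (twist Q \<gamma>) \<longleftrightarrow> cob G Q s \<gamma> = \<gamma>"
proof -
  have "inv\<^bsub>Q\<^esub> (\<gamma> g) \<otimes>\<^bsub>Q\<^esub> s \<triangleleft>\<^bsub>Q\<^esub> g \<otimes>\<^bsub>Q\<^esub> \<gamma> g = s \<longleftrightarrow> cob G Q s \<gamma> g = \<gamma> g" if g: "g \<in> carrier G" for g
  proof -
    note closed = g s Z1_closed[OF \<gamma>]
    have "inv\<^bsub>Q\<^esub> (\<gamma> g) \<otimes>\<^bsub>Q\<^esub> s \<triangleleft>\<^bsub>Q\<^esub> g \<otimes>\<^bsub>Q\<^esub> \<gamma> g = s \<longleftrightarrow> s \<triangleleft>\<^bsub>Q\<^esub> g \<otimes>\<^bsub>Q\<^esub> \<gamma> g = \<gamma> g \<otimes>\<^bsub>Q\<^esub> s"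
      using closed by (simp add: Q.m_assoc Q.inv_solve_left')
    also have "\<dots> \<longleftrightarrow> cob G Q s \<gamma> g = \<gamma> g"
      using closed by (auto simp add: cob_def Q.m_assoc inv_act Q.inv_solve_left')
    finally show ?thesis .
  qed
  moreover have "cob G Q s \<gamma> = \<gamma> \<longleftrightarrow> (\<forall>g\<in>carrier G. cob G Q s \<gamma> g = \<gamma> g)"
    using Z1_eqI[OF cob_Z1[OF s \<gamma>] \<gamma>] by metis
  ultimately show ?thesis
    using s by (auto simp: mem_H0_twist_iff)
qed

locale central_extension_hom =
  E: central_extension G R Q S \<iota> \<pi> \<sigma> + E': central_extension G R' Q' S' \<iota>' \<pi>' \<sigma>'
  for G :: "('g, 'x) monoid_scheme" and R :: "('r, 'g, 'u) ggrp_scheme"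
    and Q :: "('q, 'g, 'v) ggrp_scheme" and S :: "('s, 'g, 'w) ggrp_scheme"
    and \<iota> \<pi> \<sigma>
    and R' :: "('r1, 'g, 'u1) ggrp_scheme" and Q' :: "('q1, 'g, 'v1) ggrp_scheme"
    and S' :: "('s1, 'g, 'w1) ggrp_scheme"
    and \<iota>' \<pi>' \<sigma>' +
  fixes \<zeta> :: "'r \<Rightarrow> 'r1" and \<eta> :: "'q \<Rightarrow> 'q1" and \<theta> :: "'s \<Rightarrow> 's1"
  assumes \<zeta>: "\<zeta> \<in> g_hom G R R'" and \<eta>: "\<eta> \<in> g_hom G Q Q'" and \<theta>: "\<theta> \<in> g_hom G S S'"
    and incl_square: "r \<in> carrier R \<Longrightarrow> \<eta> (\<iota> r) = \<iota>' (\<zeta> r)"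
    and proj_square: "q \<in> carrier Q \<Longrightarrow> \<theta> (\<pi> q) = \<pi>' (\<eta> q)"
begin

sublocale z: comm_g_group_hom G R R' \<zeta>
  by (intro comm_g_group_hom.intro g_group_hom.intro g_group_hom_axioms.intro
      E.R.comm_g_group_axioms E'.R.comm_g_group_axioms E.incl.Q.g_group_axioms
      E'.incl.Q.g_group_axioms \<zeta>)

sublocale e: g_group_hom G Q Q' \<eta>
  by (intro g_group_hom.intro g_group_hom_axioms.intro
      E.incl.S.g_group_axioms E'.incl.S.g_group_axioms \<eta>)

sublocale t: g_group_hom G S S' \<theta>
  by (intro g_group_hom.intro g_group_hom_axioms.intro
      E.proj.S.g_group_axioms E'.proj.S.g_group_axioms \<theta>)

section \<open>Compatibility of the vertical maps with the constructions, and the commuting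
  squares\<close>

lemma compose_tw:
  assumes "\<rho> \<in> Z1 G R" "\<gamma> \<in> Z1 G Q"
  shows "compose (carrier G) \<eta> (E.tw \<rho> \<gamma>)
    = E'.tw (compose (carrier G) \<zeta> \<rho>) (compose (carrier G) \<eta> \<gamma>)"
  using assms by (auto simp: compose_def E.tw_def E'.tw_def fun_eq_iff Z1_closed incl_square)

lemma compose_cob_Z1:
  "\<lbrakk>q \<in> carrier Q; \<gamma> \<in> Z1 G Q\<rbrakk>
    \<Longrightarrow> compose (carrier G) \<eta> (cob G Q q \<gamma>) = cob G Q' (\<eta> q) (compose (carrier G) \<eta> \<gamma>)"
  by (simp add: e.compose_cob Z1_closed)

lemma compose_proj_square:
  "\<gamma> \<in> Z1 G Q \<Longrightarrow> compose (carrier G) \<theta> (compose (carrier G) \<pi> \<gamma>)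
    = compose (carrier G) \<pi>' (compose (carrier G) \<eta> \<gamma>)"
  by (rule compose_compose_eq) (simp_all add: proj_square)

lemma compose_incl_square:
  "\<rho> \<in> Z1 G R \<Longrightarrow> compose (carrier G) \<eta> (compose (carrier G) \<iota> \<rho>)
    = compose (carrier G) \<iota>' (compose (carrier G) \<zeta> \<rho>)"
  by (rule compose_compose_eq) (simp_all add: incl_square)

text \<open>The sections need not correspond under \<open>\<eta>\<close> and
  \<open>\<theta>\<close>. But \<open>\<eta> q\<close> is a lift of \<open>\<theta> s\<close>, and
  by \<open>conn0_eq\<close> any lift computes the connecting map.\<close>

lemma H0_square:
  assumes "s \<in> H0 G S"
  shows "H1_map G R' \<zeta> (conn0 G R Q \<iota> \<sigma> s) = conn0 G R' Q' \<iota>' \<sigma>' (\<theta> s)"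
proof -
  obtain q where q: "q \<in> carrier Q" "\<pi> q = s" "\<pi> q \<in> H0 G S"
    using assms by (rule E.H0_lift)
  have \<eta>q: "\<eta> q \<in> carrier Q'" "\<pi>' (\<eta> q) = \<theta> s" "\<pi>' (\<eta> q) \<in> H0 G S'"
    using q assms t.pointed_map_H0 by (auto simp: pointed_map_def proj_square[symmetric])
  have "compose (carrier G) \<iota>' (compose (carrier G) \<zeta> (E.bd q))
      = cob G Q' (\<eta> q) (\<lambda>g\<in>carrier G. \<one>\<^bsub>Q'\<^esub>)"
    using q by (simp add: compose_incl_square[symmetric] E.bd_Z1 E.compose_incl_bd
        compose_cob_Z1 E.incl.S.trivial_Z1 e.compose_trivial)
  then have "E'.bd (\<eta> q) = compose (carrier G) \<zeta> (E.bd q)"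
    using \<eta>q q by (intro E'.bd_eqI) (auto simp: z.compose_Z1 E.bd_Z1)
  then show ?thesis
    using E.conn0_eq[of q] E'.conn0_eq[of "\<eta> q"] q \<eta>q by (simp add: z.H1_map_class E.bd_Z1)
qed

lemma H1_incl_square:
  "x \<in> H1 G R \<Longrightarrow> H1_map G Q' \<eta> (H1_map G Q \<iota> x) = H1_map G Q' \<iota>' (H1_map G R' \<zeta> x)"
  by (elim H1E) (simp add: E.incl.H1_map_class e.H1_map_class z.H1_map_class
      E'.incl.H1_map_class E.incl.compose_Z1 z.compose_Z1 compose_incl_square)

lemma H1_proj_square:
  "x \<in> H1 G Q \<Longrightarrow> H1_map G S' \<theta> (H1_map G S \<pi> x) = H1_map G S' \<pi>' (H1_map G Q' \<eta> x)"
  by (elim H1E) (simp add: E.proj.H1_map_class e.H1_map_class t.H1_map_class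
      E'.proj.H1_map_class E.proj.compose_Z1 e.compose_Z1 compose_proj_square)

lemma H2_square:
  assumes "x \<in> H1 G S"
  shows "H2_map G R' \<zeta> (conn1 G R Q \<iota> \<sigma> x) = conn1 G R' Q' \<iota>' \<sigma>' (H1_map G S' \<theta> x)"
proof -
  obtain \<gamma> where \<gamma>: "\<gamma> \<in> Z1 G S" "x = H1_class G S \<gamma>"
    using assms by (rule H1E)
  define a where "a = (\<lambda>g. \<sigma> (\<gamma> g))"
  have a: "E.lifts a \<gamma>"
    unfolding a_def by (rule E.lifts_section[OF \<gamma>(1)])
  have \<gamma>': "compose (carrier G) \<theta> \<gamma> \<in> Z1 G S'"
    using \<gamma>(1) by (rule t.compose_Z1)
  \<comment> \<open>Pushing the lift forward along \<open>\<eta>\<close> avoids comparing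
    \<open>\<sigma>\<close> with \<open>\<sigma>'\<close>; its obstruction is \<open>\<zeta>\<close>
    of the old one.\<close>
  have a': "E'.lifts (\<lambda>g. \<eta> (a g)) (compose (carrier G) \<theta> \<gamma>)"
    using a by (auto simp: E.lifts_def E'.lifts_def compose_def proj_square[symmetric])
  have "E'.obs (\<lambda>g. \<eta> (a g)) = compose (carrier G \<times> carrier G) \<zeta> (E.obs a)"
  proof (rule extensionalityI[of _ "carrier G \<times> carrier G"])
    fix p assume "p \<in> carrier G \<times> carrier G"
    then obtain g h where p: "p = (g, h)" and gh: "g \<in> carrier G" "h \<in> carrier G" by auto
    note closed = gh E.lifts_closed[OF a] E.obs_closed[OF \<gamma>(1) a]
    have "\<iota>' (\<zeta> (E.obs a (g, h))) \<otimes>\<^bsub>Q'\<^esub> \<eta> (a (g \<otimes>\<^bsub>G\<^esub> h)) = \<eta> (a g \<triangleleft>\<^bsub>Q\<^esub> h \<otimes>\<^bsub>Q\<^esub> a h)"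
      using closed by (simp add: E.obs_mult[OF \<gamma>(1) a, symmetric] incl_square)
    then have "E'.obs (\<lambda>g. \<eta> (a g)) (g, h) = \<zeta> (E.obs a (g, h))"
      using closed by (intro E'.obs_eqI[OF \<gamma>' a']) (simp_all add: e.hom_act)
    then show "E'.obs (\<lambda>g. \<eta> (a g)) p = compose (carrier G \<times> carrier G) \<zeta> (E.obs a) p"
      using p gh by (simp add: compose_def)
  qed (simp_all add: E'.obs_def)
  then show ?thesis
    using \<gamma> a \<gamma>' a'
    by (simp add: E.conn1_eq E'.conn1_eq t.H1_map_class z.H2_map_class E.obs_Z2)
qed

lemma H1_middle_surj:
  assumes h2: "H1_map G R' \<zeta> ` H1 G R = H1 G R'"
    and h4: "H1_map G S' \<theta> ` H1 G S = H1 G S'"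
    and h5: "inj_on (H2_map G R' \<zeta>) (H2 G R)"
  shows "H1_map G Q' \<eta> ` H1 G Q = H1 G Q'"
proof
  show "H1_map G Q' \<eta> ` H1 G Q \<subseteq> H1 G Q'"
    using e.pointed_map_H1 by (auto simp: pointed_map_def)
  show "H1 G Q' \<subseteq> H1_map G Q' \<eta> ` H1 G Q"
  proof
    fix x assume x: "x \<in> H1 G Q'"
    then obtain \<delta> where \<delta>: "\<delta> \<in> Z1 G Q'" "x = H1_class G Q' \<delta>" by (rule H1E)
    have "H1_map G S' \<pi>' x \<in> H1 G S'"
      using x E'.proj.pointed_map_H1 by (auto simp: pointed_map_def)
    then obtain y where y: "y \<in> H1 G S" "H1_map G S' \<theta> y = H1_map G S' \<pi>' x"
      using h4 by (metis imageE)
    \<comment> \<open>The image of \<open>y\<close> comes from H^1(G,Q'), so its obstruction is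
      trivial. Injectivity of h5 is invoked only against the base class.\<close>
    have "H2_map G R' \<zeta> (conn1 G R Q \<iota> \<sigma> y) = H2_map G R' \<zeta> (H2_base G R)"
      using y \<delta> z.pointed_map_H2
      by (simp add: H2_square E'.proj.H1_map_class E'.conn1_proj pointed_map_def)
    moreover have "conn1 G R Q \<iota> \<sigma> y \<in> H2 G R" "H2_base G R \<in> H2 G R"
      using E.pointed_map_conn1 y(1)
      by (auto simp: pointed_map_def H2_base_def E.R.H2_class_in_H2 E.R.trivial_Z2)
    ultimately have "conn1 G R Q \<iota> \<sigma> y = H2_base G R"
      using h5 by (metis inj_onD)
    then have "y \<in> H1_map G S \<pi> ` H1 G Q"
      using E.exact_at_H1_quotient y(1) by (simp add: exact_at_def)
    then obtain w where w: "w \<in> H1 G Q" "H1_map G S \<pi> w = y"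
      by (metis imageE)
    obtain \<gamma> where \<gamma>: "\<gamma> \<in> Z1 G Q" "w = H1_class G Q \<gamma>" using w(1) by (rule H1E)
    define \<gamma>' where "\<gamma>' = compose (carrier G) \<eta> \<gamma>"
    have \<gamma>': "\<gamma>' \<in> Z1 G Q'" using \<gamma>(1) by (simp add: \<gamma>'_def e.compose_Z1)
    have "H1_map G Q' \<eta> w = H1_class G Q' \<gamma>'"
      using \<gamma> by (simp add: e.H1_map_class \<gamma>'_def)
    then have "H1_map G S' \<pi>' (H1_class G Q' \<gamma>') = H1_map G S' \<pi>' (H1_class G Q' \<delta>)"
      using H1_proj_square[OF w(1)] w(2) y(2) \<delta>(2) by simp
    then obtain q \<rho> where q: "q \<in> carrier Q'" "\<rho> \<in> Z1 G R'" "\<delta> = E'.tw \<rho> (cob G Q' q \<gamma>')"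
      using E'.fibre_H1[OF \<gamma>' \<delta>(1)] \<gamma>' \<delta>(1) by (auto simp: E'.proj.H1_map_class)
    \<comment> \<open>Surjectivity of h2 realises \<open>\<rho>\<close> only up to a coboundary by
      some \<open>r\<close>; \<open>cob_incl_tw\<close> turns that defect into a move by
      \<open>\<iota>' r\<close>, invisible in H^1(G,Q').\<close>
    have "H1_class G R' \<rho> \<in> H1_map G R' \<zeta> ` H1 G R"
      using q h2 by (simp add: E'.incl.Q.H1_class_in_H1)
    then obtain \<tau> where \<tau>: "\<tau> \<in> Z1 G R"
      "H1_class G R' (compose (carrier G) \<zeta> \<tau>) = H1_class G R' \<rho>"
      by (auto elim!: H1E simp: z.H1_map_class)
    define \<tau>' where "\<tau>' = compose (carrier G) \<zeta> \<tau>"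
    have \<tau>': "\<tau>' \<in> Z1 G R'" using \<tau>(1) by (simp add: \<tau>'_def z.compose_Z1)
    obtain r where r: "r \<in> carrier R'" "\<rho> = cob G R' r \<tau>'"
      using \<tau> \<tau>' q(2) by (auto simp: \<tau>'_def E'.incl.Q.H1_class_eq_iff)
    have "\<delta> = cob G Q' (\<iota>' r) (cob G Q' q (E'.tw \<tau>' \<gamma>'))"
      using q r \<tau>' \<gamma>'
      by (simp add: E'.cob_tw[of \<tau>' \<gamma>' q] E'.cob_incl_tw[of \<tau>' _ r] E'.incl.S.cob_Z1)
    then have "x = H1_class G Q' (E'.tw \<tau>' \<gamma>')"
      using \<delta>(2) q(1) r(1) \<tau>' \<gamma>'
      by (simp add: E'.incl.S.H1_class_cob E'.incl.S.cob_Z1 E'.tw_Z1)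
    also have "\<dots> = H1_map G Q' \<eta> (H1_class G Q (E.tw \<tau> \<gamma>))"
      using \<tau>(1) \<gamma>(1) by (simp add: e.H1_map_class E.tw_Z1 compose_tw \<tau>'_def \<gamma>'_def)
    finally show "x \<in> H1_map G Q' \<eta> ` H1 G Q"
      using \<tau>(1) \<gamma>(1) by (simp add: E.incl.S.H1_class_in_H1 E.tw_Z1)
  qed
qed

text \<open>
  After moving one of two cocycles with the same image inside its class, the two differ by an
  \<open>R\<close>-cocycle \<open>\<rho>\<close>, while the element \<open>q'\<close> conjugating their images projects to a fixed point of the
  twisted group \<open>S'\<close>. Lifting that fixed point to \<open>S\<close> and then to \<open>Q\<close> corrects \<open>q'\<close> to an element
  of \<open>R'\<close>, so that injectivity on \<open>H\<^sup>1(G, R)\<close> applies.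
\<close>

lemma H1_middle_inj:
  assumes h2: "inj_on (H1_map G R' \<zeta>) (H1 G R)"
    and h4: "inj_on (H1_map G S' \<theta>) (H1 G S)"
    and fixed: "\<And>\<gamma>. \<gamma> \<in> Z1 G S \<Longrightarrow>
      \<theta> ` H0 G (twist S \<gamma>) = H0 G (twist S' (compose (carrier G) \<theta> \<gamma>))"
  shows "inj_on (H1_map G Q' \<eta>) (H1 G Q)"
proof (rule inj_onI)
  fix x y assume x: "x \<in> H1 G Q" and y: "y \<in> H1 G Q" and xy: "H1_map G Q' \<eta> x = H1_map G Q' \<eta> y"
  obtain \<gamma>\<^sub>0 where \<gamma>\<^sub>0: "\<gamma>\<^sub>0 \<in> Z1 G Q" "x = H1_class G Q \<gamma>\<^sub>0" using x by (rule H1E)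
  obtain \<delta> where \<delta>: "\<delta> \<in> Z1 G Q" "y = H1_class G Q \<delta>" using y by (rule H1E)
  have "H1_map G S' \<theta> (H1_map G S \<pi> x) = H1_map G S' \<theta> (H1_map G S \<pi> y)"
    using x y xy by (simp add: H1_proj_square)
  moreover have "H1_map G S \<pi> x \<in> H1 G S" "H1_map G S \<pi> y \<in> H1 G S"
    using x y E.proj.pointed_map_H1 by (auto simp: pointed_map_def)
  ultimately have "H1_map G S \<pi> x = H1_map G S \<pi> y"
    using h4 by (metis inj_onD)
  then obtain p \<rho> where p: "p \<in> carrier Q" "\<rho> \<in> Z1 G R" "\<delta> = E.tw \<rho> (cob G Q p \<gamma>\<^sub>0)"
    using E.fibre_H1[OF \<gamma>\<^sub>0(1) \<delta>(1)] \<gamma>\<^sub>0 \<delta> by (auto simp: E.proj.H1_map_class)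
  define \<gamma> where "\<gamma> = cob G Q p \<gamma>\<^sub>0"
  have \<gamma>: "\<gamma> \<in> Z1 G Q" "x = H1_class G Q \<gamma>"
    using p \<gamma>\<^sub>0 by (simp_all add: \<gamma>_def E.incl.S.cob_Z1 E.incl.S.H1_class_cob)
  have \<delta>_eq: "\<delta> = E.tw \<rho> \<gamma>" using p by (simp add: \<gamma>_def)
  define \<gamma>' where "\<gamma>' = compose (carrier G) \<eta> \<gamma>"
  define \<rho>' where "\<rho>' = compose (carrier G) \<zeta> \<rho>"
  have \<gamma>': "\<gamma>' \<in> Z1 G Q'" using \<gamma>(1) by (simp add: \<gamma>'_def e.compose_Z1)
  have \<rho>': "\<rho>' \<in> Z1 G R'" using p(2) by (simp add: \<rho>'_def z.compose_Z1)
  have "compose (carrier G) \<eta> \<delta> = E'.tw \<rho>' \<gamma>'"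
    using p(2) \<gamma>(1) by (simp add: \<delta>_eq compose_tw \<rho>'_def \<gamma>'_def)
  then have "H1_class G Q' \<gamma>' = H1_class G Q' (E'.tw \<rho>' \<gamma>')"
    using xy \<gamma> \<delta> by (simp add: e.H1_map_class \<gamma>'_def)
  then obtain q' where q': "q' \<in> carrier Q'" "E'.tw \<rho>' \<gamma>' = cob G Q' q' \<gamma>'"
    using \<gamma>' \<rho>' by (auto simp: E'.incl.S.H1_class_eq_iff E'.tw_Z1)

  define \<beta> where "\<beta> = compose (carrier G) \<pi> \<gamma>"
  have \<beta>: "\<beta> \<in> Z1 G S" using \<gamma>(1) by (simp add: \<beta>_def E.proj.compose_Z1)
  have \<beta>': "compose (carrier G) \<theta> \<beta> = compose (carrier G) \<pi>' \<gamma>'"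
    using \<gamma>(1) by (simp add: \<beta>_def \<gamma>'_def compose_proj_square)
  \<comment> \<open>Projecting the equation for \<open>q'\<close> to S' erases
    \<open>\<rho>'\<close>, so \<open>\<pi>' q'\<close> stabilises the image of
    \<open>\<gamma>'\<close>: it is a fixed point of the twist.\<close>
  have "cob G S' (\<pi>' q') (compose (carrier G) \<pi>' \<gamma>') = compose (carrier G) \<pi>' (E'.tw \<rho>' \<gamma>')"
    using q' \<gamma>' by (simp add: E'.proj.compose_cob Z1_closed)
  also have "\<dots> = compose (carrier G) \<pi>' \<gamma>'"
    using \<rho>' \<gamma>' by (rule E'.compose_proj_tw)
  finally have "\<pi>' q' \<in> H0 G (twist S' (compose (carrier G) \<theta> \<beta>))"
    using q'(1) \<gamma>' by (simp add: \<beta>' E'.proj.S.mem_H0_twist_iff_cob E'.proj.compose_Z1)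
  then obtain s where s: "s \<in> H0 G (twist S \<beta>)" "\<pi>' q' = \<theta> s"
    using fixed[OF \<beta>] by blast
  then have s': "s \<in> carrier S" "cob G S s \<beta> = \<beta>"
    using \<beta> E.proj.S.mem_H0_twist_iff_cob by (auto simp: mem_H0_twist_iff)
  then obtain u where u: "u \<in> carrier Q" "\<pi> u = s" by (metis E.proj_lift)
  have "\<pi>' (\<eta> u) = \<pi>' q'" using u s by (simp add: proj_square[symmetric])
  \<comment> \<open>The central factor is written on the right so that \<open>cob_cob\<close> splits
    the move by \<open>\<eta> u\<close> into the one by \<open>q'\<close> followed by the one by
    \<open>\<iota>' r'\<close>.\<close>
  then obtain r' where r': "r' \<in> carrier R'" "\<eta> u = q' \<otimes>\<^bsub>Q'\<^esub> \<iota>' r'"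
    using u(1) q'(1) by (metis E'.fibre_lift E'.incl_commute e.hom_closed)

  have "compose (carrier G) \<pi> \<gamma> = compose (carrier G) \<pi> (cob G Q u \<gamma>)"
    using u s' \<gamma>(1) by (simp add: E.proj.compose_cob Z1_closed \<beta>_def)
  \<comment> \<open>As \<open>s\<close> stabilises \<open>\<beta>\<close>, the move by
    \<open>u\<close> stays in the fibre of \<open>\<gamma>\<close>. The cocycle
    \<open>\<tau>\<close> plays the role of \<open>bd u\<close> for the sequence twisted by
    \<open>\<gamma>\<close>.\<close>
  then obtain \<tau> where \<tau>: "\<tau> \<in> Z1 G R" "cob G Q u \<gamma> = E.tw \<tau> \<gamma>"
    using \<gamma>(1) u(1) by (metis E.fibre_Z1 E.incl.S.cob_Z1)
  define \<tau>' where "\<tau>' = compose (carrier G) \<zeta> \<tau>"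
  have \<tau>': "\<tau>' \<in> Z1 G R'" using \<tau>(1) by (simp add: \<tau>'_def z.compose_Z1)
  have "E'.tw \<tau>' \<gamma>' = compose (carrier G) \<eta> (cob G Q u \<gamma>)"
    using \<tau> \<gamma>(1) by (simp add: compose_tw \<tau>'_def \<gamma>'_def)
  also have "\<dots> = cob G Q' (\<iota>' r') (cob G Q' q' \<gamma>')"
    using u(1) \<gamma>(1) \<gamma>' q'(1) r' by (simp add: compose_cob_Z1 \<gamma>'_def[symmetric] E'.incl.S.cob_cob)
  also have "\<dots> = E'.tw (cob G R' r' \<rho>') \<gamma>'"
    using \<gamma>' \<rho>' r'(1) by (simp add: q'(2)[symmetric] E'.cob_incl_tw)
  \<comment> \<open>Both sides come from moving \<open>\<gamma>'\<close> by \<open>\<eta> u\<close>;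
    freeness of the action converts the equality in Q' into a cohomology between
    R'-cocycles.\<close>
  finally have "\<tau>' = cob G R' r' \<rho>'"
    using \<gamma>' \<rho>' \<tau>' r'(1) by (auto intro: E'.tw_inject simp: E'.incl.Q.cob_Z1)
  then have "H1_map G R' \<zeta> (H1_class G R \<tau>) = H1_map G R' \<zeta> (H1_class G R \<rho>)"
    using \<tau>(1) p(2) \<rho>' r'(1)
    by (simp add: z.H1_map_class \<tau>'_def[symmetric] \<rho>'_def[symmetric] E'.incl.Q.H1_class_cob)
  then have "H1_class G R \<rho> = H1_class G R \<tau>"
    using h2 \<tau>(1) p(2) by (simp add: inj_on_eq_iff E.incl.Q.H1_class_in_H1)
  then obtain r where r: "r \<in> carrier R" "\<tau> = cob G R r \<rho>"
    using \<tau>(1) p(2) by (auto simp: E.incl.Q.H1_class_eq_iff)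
  \<comment> \<open>Both sides equal \<open>tw \<tau> \<gamma>\<close>: the left by the choice of
    \<open>\<tau>\<close>, the right because \<open>\<tau>\<close> is the move of
    \<open>\<rho>\<close> by \<open>r\<close>.\<close>
  have "cob G Q u \<gamma> = cob G Q (\<iota> r) \<delta>"
    using r p(2) \<gamma>(1) \<tau>(2) by (simp add: \<delta>_eq E.cob_incl_tw)
  then have "H1_class G Q (cob G Q u \<gamma>) = H1_class G Q (cob G Q (\<iota> r) \<delta>)" by simp
  then show "x = y"
    using \<gamma> \<delta> u(1) r(1) by (simp add: E.incl.S.H1_class_cob)
qed

end

theorem theorem3p1p2:
  fixes G :: "'g monoid"
    and R :: "('r, 'g) ggrp" and Q :: "('q, 'g) ggrp" and S :: "('s, 'g) ggrp"
    and R' :: "('r1, 'g) ggrp" and Q' :: "('q1, 'g) ggrp" and S' :: "('s1, 'g) ggrp"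
    and \<iota> :: "'r \<Rightarrow> 'q" and \<pi> :: "'q \<Rightarrow> 's" and \<sigma> :: "'s \<Rightarrow> 'q"
    and \<iota>' :: "'r1 \<Rightarrow> 'q1" and \<pi>' :: "'q1 \<Rightarrow> 's1" and \<sigma>' :: "'s1 \<Rightarrow> 'q1"
    and \<zeta> :: "'r \<Rightarrow> 'r1" and \<eta> :: "'q \<Rightarrow> 'q1" and \<theta> :: "'s \<Rightarrow> 's1"
  assumes "group G"
    and "g_short_exact G R Q S \<iota> \<pi>" and "\<iota> ` carrier R \<subseteq> center Q"
    and "g_short_exact G R' Q' S' \<iota>' \<pi>'" and "\<iota>' ` carrier R' \<subseteq> center Q'"
    and "set_section Q S \<pi> \<sigma>" and "set_section Q' S' \<pi>' \<sigma>'"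
    and "\<zeta> \<in> g_hom G R R'" and "\<eta> \<in> g_hom G Q Q'" and "\<theta> \<in> g_hom G S S'"
    and "\<forall>r\<in>carrier R. \<eta> (\<iota> r) = \<iota>' (\<zeta> r)"
    and "\<forall>q\<in>carrier Q. \<theta> (\<pi> q) = \<pi>' (\<eta> q)"
  shows
    \<comment> \<open>the induced diagram: exact rows, vertical maps of pointed sets, commuting squares\<close>
    "(exact_row G R Q S \<iota> \<pi> \<sigma> \<and> exact_row G R' Q' S' \<iota>' \<pi>' \<sigma>' \<and>
      pointed_map (H0 G S) \<one>\<^bsub>S\<^esub> (H0 G S') \<one>\<^bsub>S'\<^esub> \<theta> \<and>
      pointed_map (H1 G R) (H1_base G R) (H1 G R') (H1_base G R') (H1_map G R' \<zeta>) \<and>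
      pointed_map (H1 G Q) (H1_base G Q) (H1 G Q') (H1_base G Q') (H1_map G Q' \<eta>) \<and>
      pointed_map (H1 G S) (H1_base G S) (H1 G S') (H1_base G S') (H1_map G S' \<theta>) \<and>
      pointed_map (H2 G R) (H2_base G R) (H2 G R') (H2_base G R') (H2_map G R' \<zeta>) \<and>
      (\<forall>s\<in>H0 G S. H1_map G R' \<zeta> (conn0 G R Q \<iota> \<sigma> s) = conn0 G R' Q' \<iota>' \<sigma>' (\<theta> s)) \<and>
      (\<forall>x\<in>H1 G R. H1_map G Q' \<eta> (H1_map G Q \<iota> x) = H1_map G Q' \<iota>' (H1_map G R' \<zeta> x)) \<and>
      (\<forall>x\<in>H1 G Q. H1_map G S' \<theta> (H1_map G S \<pi> x) = H1_map G S' \<pi>' (H1_map G Q' \<eta> x)) \<and>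
      (\<forall>x\<in>H1 G S. H2_map G R' \<zeta> (conn1 G R Q \<iota> \<sigma> x) = conn1 G R' Q' \<iota>' \<sigma>' (H1_map G S' \<theta> x)))
     \<and>
     \<comment> \<open>(i)\<close>
     (H1_map G R' \<zeta> ` H1 G R = H1 G R' \<and>
      H1_map G S' \<theta> ` H1 G S = H1 G S' \<and>
      inj_on (H2_map G R' \<zeta>) (H2 G R)
      \<longrightarrow> H1_map G Q' \<eta> ` H1 G Q = H1 G Q')
     \<and>
     \<comment> \<open>(ii)\<close>
     (inj_on (H1_map G R' \<zeta>) (H1 G R) \<and>
      inj_on (H1_map G S' \<theta>) (H1 G S) \<and>
      (\<forall>\<gamma>\<in>Z1 G S. \<theta> ` H0 G (twist S \<gamma>) = H0 G (twist S' (compose (carrier G) \<theta> \<gamma>)))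
      \<longrightarrow> inj_on (H1_map G Q' \<eta>) (H1 G Q))
     \<and>
     \<comment> \<open>(iii)\<close>
     ((H1_map G R' \<zeta> ` H1 G R = H1 G R' \<and>
       H1_map G S' \<theta> ` H1 G S = H1 G S' \<and>
       inj_on (H2_map G R' \<zeta>) (H2 G R)) \<and>
      (inj_on (H1_map G R' \<zeta>) (H1 G R) \<and>
       inj_on (H1_map G S' \<theta>) (H1 G S) \<and>
       (\<forall>\<gamma>\<in>Z1 G S. \<theta> ` H0 G (twist S \<gamma>) = H0 G (twist S' (compose (carrier G) \<theta> \<gamma>))))
      \<longrightarrow> pointed_iso (H1 G Q) (H1_base G Q) (H1 G Q') (H1_base G Q') (H1_map G Q' \<eta>))"
proof -
  interpret central_extension_hom G R Q S \<iota> \<pi> \<sigma> R' Q' S' \<iota>' \<pi>' \<sigma>' \<zeta> \<eta> \<theta>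
    using assms
    by (auto simp: central_extension_hom_def central_extension_hom_axioms_def central_extension_def)
  have "H1_map G Q' \<eta> ` H1 G Q = H1 G Q' \<longrightarrow> inj_on (H1_map G Q' \<eta>) (H1 G Q) \<longrightarrow>
      pointed_iso (H1 G Q) (H1_base G Q) (H1 G Q') (H1_base G Q') (H1_map G Q' \<eta>)"
    using e.pointed_map_H1 by (simp add: pointed_iso_def bij_betw_def)
  then show ?thesis
    using H1_middle_surj H1_middle_inj
    by (simp add: E.exact_row E'.exact_row t.pointed_map_H0 z.pointed_map_H1 e.pointed_map_H1
        t.pointed_map_H1 z.pointed_map_H2 H0_square H1_incl_square H1_proj_square H2_square)
qed

end
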